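(* Let $L$ be a Lagrangian, $f$ a constraint function and $H$ the associated Hamiltonian. Assume that $H$ is ${}_{\rm c}D^\alpha_-$-invariant under the action of three one parameter groups of diffeomorphisms $(\Phi_i)_{i=1,2,3}$, where $\Phi_i=\{\phi_i(s,\cdot)\}_{s\in\mathbb{R}}$. Let $(q,u,p)$ be a solution of the fractional Pontryagin's system, and let $g$ denote the function $g(t)=\frac{\partial\phi_1}{\partial s}(0,q(t))$. If $g,p\in\mathscr{C}^\infty([a,b],\mathbb{R}^d)$ and the pair $(g_1,g_2)=(g,p)$ satisfies Condition (C), then the following equality holds on $(a,b)$: $$\frac{d}{dt}\left[\sum_{r=0}^{\infty}(-1)^r I^{r+1-\alpha}_-\big(g-g(a)\big)\cdot p^{(r)}+g^{(r)}\cdot I^{r+1-\alpha}_+ p\right]=0.$$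
   Context: Let $a<b$ be reals, $d,m\in\mathbb{N}^*$, $0<\alpha\le 1$, $A\in\mathbb{R}^d$; $\Vert\cdot\Vert$ is the Euclidean norm; $[\alpha]$ is the floor of $\alpha$ (so $\mathscr{C}^{[\alpha]}$ is $\mathscr{C}^0$ if $\alpha<1$ and $\mathscr{C}^1$ if $\alpha=1$). Fractional operators. For $g\in\mathscr{C}^0([a,b],\mathbb{R}^d)$ and $\beta>0$: $I^\beta_- g(t)=\frac{1}{\Gamma(\beta)}\int_a^t (t-y)^{\beta-1}g(y)\,dy$ for $t\in(a,b]$, and $I^\beta_+ g(t)=\frac{1}{\Gamma(\beta)}\int_t^b (y-t)^{\beta-1}g(y)\,dy$ for $t\in[a,b)$, extended continuously by $0$ at $a$, resp. $b$; $I^0_\pm g=g$. Riemann-Liouville derivatives: $D^\alpha_- g=\frac{d}{dt}(I^{1-\alpha}_- g)$ on $(a,b]$, $D^\alpha_+ g=-\frac{d}{dt}(I^{1-\alpha}_+ g)$ on $[a,b)$. Left Caputo derivative: ${}_{\rm c}D^\alpha_- g=D^\alpha_-(g-g(a))$ on $(a,b]$. These are considered whenever the right-hand sides are defined. A function defined on $(a,b]$ (resp. $[a,b)$) is regarded as an element of $\mathscr{C}^0([a,b],\mathbb{R}^d)$ if it is continuous there and extends continuously to $t=a$ (resp. $t=b$). A constraint function is a $\mathscr{C}^2$ map $f:\mathbb{R}^d\times\mathbb{R}^m\times[a,b]\to\mathbb{R}^d$, $(x,v,t)\mapsto f(x,v,t)$, for which there is $M\ge0$ with $\Vert f(x_1,v,t)-f(x_2,v,t)\Vert\le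 M\Vert x_1-x_2\Vert$ for all $x_1,x_2\in\mathbb{R}^d$, $v\in\mathbb{R}^m$, $t\in[a,b]$. A Lagrangian is a $\mathscr{C}^2$ map $L:\mathbb{R}^d\times\mathbb{R}^m\times[a,b]\to\mathbb{R}$, $(x,v,t)\mapsto L(x,v,t)$. The associated Hamiltonian is $H(x,v,w,t)=L(x,v,t)+w\cdot f(x,v,t)$ on $\mathbb{R}^d\times\mathbb{R}^m\times\mathbb{R}^d\times[a,b]$. Fractional Pontryagin's system, for $(q,u,p)\in\mathscr{C}^{[\alpha]}([a,b],\mathbb{R}^d)\times\mathscr{C}^0([a,b],\mathbb{R}^m)\times\mathscr{C}^{[\alpha]}([a,b],\mathbb{R}^d)$: $${}_{\rm c}D^\alpha_- q=\frac{\partial H}{\partial w}(q,u,p,t),\quad D^\alpha_+ p=\frac{\partial H}{\partial x}(q,u,p,t),\quad \frac{\partial H}{\partial v}(q,u,p,t)=0,\quad (q(a),p(b))=(A,0).$$ A one parameter group of diffeomorphisms of $\mathbb{R}^n$ is a family $\Phi=\{\phi(s,\cdot)\}_{s\in\mathbb{R}}$ of diffeomorphisms $\phi(s,\cdot):\mathbb{R}^n\to\mathbb{R}^n$ such that $\phi(0,\cdot)=\mathrm{Id}_{\mathbb{R}^n}$, $\phi(s,\cdot)\circ\phi(s',\cdot)=\phi(s+s',\cdot)$ for all $s,s'\in\mathbb{R}$, and $\phi$ is of class $\mathscr{C}^2$. Let $\Phi_1,\Phi_2,\Phi_3$ be one parameter groups of diffeomorphisms of $\mathbb{R}^d,\mathbb{R}^m,\mathbb{R}^d$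 respectively. $H$ is said to be ${}_{\rm c}D^\alpha_-$-invariant under the action of $(\Phi_i)_{i=1,2,3}$ if for any solution $(q,u,p)$ of the fractional Pontryagin's system and any $s\in\mathbb{R}$, $$H\big(\phi_1(s,q),\phi_2(s,u),\phi_3(s,p),t\big)-\phi_3(s,p)\cdot{}_{\rm c}D^\alpha_-\big(\phi_1(s,q)\big)=H(q,u,p,t)-p\cdot{}_{\rm c}D^\alpha_- q.$$ Condition (C) for $g_1,g_2\in\mathscr{C}^\infty([a,b],\mathbb{R}^d)$: the sequences of functions $\big(I^{n-\alpha}_-(g_1-g_1(a))\cdot g_2^{(n)}\big)_{n\in\mathbb{N}^*}$ and $\big(g_1^{(n)}\cdot I^{n-\alpha}_+ g_2\big)_{n\in\mathbb{N}^*}$ converge uniformly to $0$ on $[a,b]$. Here $g^{(r)}$ denotes the $r$-th derivative. *)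

theory Defs
  imports "HOL-Analysis.Analysis"
begin

section \<open>Differentiability classes\<close>

text \<open>Curves on \<open>[a,b]\<close>: all derivatives are taken within \<open>[a,b]\<close>, hence are one-sided
  at the end points.\<close>

definition nth_deriv ::
  "real \<Rightarrow> real \<Rightarrow> nat \<Rightarrow> (real \<Rightarrow> 'a::real_normed_vector) \<Rightarrow> real \<Rightarrow> 'a" where
  "nth_deriv a b n g =
     ((\<lambda>h t. vector_derivative h (at t within {a..b})) ^^ n) g"

definition Ck_curve ::
  "real \<Rightarrow> real \<Rightarrow> nat \<Rightarrow> (real \<Rightarrow> 'a::real_normed_vector) \<Rightarrow> bool" where
  "Ck_curve a b k g \<longleftrightarrow>
     (\<forall>r<k. nth_deriv a b r g differentiable_on {a..b}) \<and>
     continuous_on {a..b} (nth_deriv a b k g)"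

definition smooth_curve ::
  "real \<Rightarrow> real \<Rightarrow> (real \<Rightarrow> 'a::real_normed_vector) \<Rightarrow> bool" where
  "smooth_curve a b g \<longleftrightarrow> (\<forall>k. Ck_curve a b k g)"

text \<open>Maps on \<open>S\<close> with derivatives relative to \<open>S\<close>. Only convex sets \<open>S\<close> with non-empty
  interior are used, so the derivatives are uniquely determined at every point of \<open>S\<close>.\<close>

definition C1_on ::
  "'a::real_normed_vector set \<Rightarrow> ('a \<Rightarrow> 'b::real_normed_vector) \<Rightarrow> bool" where
  "C1_on S f \<longleftrightarrow>
     (\<exists>F1 :: 'a \<Rightarrow> 'a \<Rightarrow>\<^sub>L 'b.
        (\<forall>x\<in>S. (f has_derivative blinfun_apply (F1 x)) (at x within S)) \<and>
        continuous_on S F1)"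

definition C2_on ::
  "'a::real_normed_vector set \<Rightarrow> ('a \<Rightarrow> 'b::real_normed_vector) \<Rightarrow> bool" where
  "C2_on S f \<longleftrightarrow>
     (\<exists>(F1 :: 'a \<Rightarrow> 'a \<Rightarrow>\<^sub>L 'b) (F2 :: 'a \<Rightarrow> 'a \<Rightarrow>\<^sub>L ('a \<Rightarrow>\<^sub>L 'b)).
        (\<forall>x\<in>S. (f has_derivative blinfun_apply (F1 x)) (at x within S)) \<and>
        (\<forall>x\<in>S. (F1 has_derivative blinfun_apply (F2 x)) (at x within S)) \<and>
        continuous_on S F2)"


section \<open>Fractional operators\<close>

text \<open>For \<open>\<beta> > 0\<close> the integral over a single point vanishes, so the value is \<open>0\<close> at \<open>t = a\<close>
  (left) and at \<open>t = b\<close> (right). The convention \<open>0 powr x = 0\<close> affects the integrand at a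
  single point only.\<close>

definition frac_int_left ::
  "real \<Rightarrow> real \<Rightarrow> (real \<Rightarrow> 'a::euclidean_space) \<Rightarrow> real \<Rightarrow> 'a" where
  "frac_int_left \<beta> a g t =
     (if \<beta> = 0 then g t
      else (1 / Gamma \<beta>) *\<^sub>R integral {a..t} (\<lambda>y. ((t - y) powr (\<beta> - 1)) *\<^sub>R g y))"

definition frac_int_right ::
  "real \<Rightarrow> real \<Rightarrow> (real \<Rightarrow> 'a::euclidean_space) \<Rightarrow> real \<Rightarrow> 'a" where
  "frac_int_right \<beta> b g t =
     (if \<beta> = 0 then g t
      else (1 / Gamma \<beta>) *\<^sub>R integral {t..b} (\<lambda>y. ((y - t) powr (\<beta> - 1)) *\<^sub>R g y))"

definition RL_left_exists ::
  "real \<Rightarrow> real \<Rightarrow> real \<Rightarrow> (real \<Rightarrow> 'a::euclidean_space) \<Rightarrow> bool" where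
  "RL_left_exists \<alpha> a b g \<longleftrightarrow>
     (\<forall>t\<in>{a<..b}. frac_int_left (1 - \<alpha>) a g differentiable (at t within {a..b}))"

definition RL_left ::
  "real \<Rightarrow> real \<Rightarrow> real \<Rightarrow> (real \<Rightarrow> 'a::euclidean_space) \<Rightarrow> real \<Rightarrow> 'a" where
  "RL_left \<alpha> a b g t =
     vector_derivative (frac_int_left (1 - \<alpha>) a g) (at t within {a..b})"

definition RL_right_exists ::
  "real \<Rightarrow> real \<Rightarrow> real \<Rightarrow> (real \<Rightarrow> 'a::euclidean_space) \<Rightarrow> bool" where
  "RL_right_exists \<alpha> a b g \<longleftrightarrow>
     (\<forall>t\<in>{a..<b}. frac_int_right (1 - \<alpha>) b g differentiable (at t within {a..b}))"

definition RL_right ::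
  "real \<Rightarrow> real \<Rightarrow> real \<Rightarrow> (real \<Rightarrow> 'a::euclidean_space) \<Rightarrow> real \<Rightarrow> 'a" where
  "RL_right \<alpha> a b g t =
     - vector_derivative (frac_int_right (1 - \<alpha>) b g) (at t within {a..b})"

definition caputo_left_exists ::
  "real \<Rightarrow> real \<Rightarrow> real \<Rightarrow> (real \<Rightarrow> 'a::euclidean_space) \<Rightarrow> bool" where
  "caputo_left_exists \<alpha> a b g \<longleftrightarrow> RL_left_exists \<alpha> a b (\<lambda>t. g t - g a)"

definition caputo_left ::
  "real \<Rightarrow> real \<Rightarrow> real \<Rightarrow> (real \<Rightarrow> 'a::euclidean_space) \<Rightarrow> real \<Rightarrow> 'a" where
  "caputo_left \<alpha> a b g = RL_left \<alpha> a b (\<lambda>t. g t - g a)"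


section \<open>Fractional Pontryagin's system\<close>

definition constraint_function ::
  "real \<Rightarrow> real \<Rightarrow> (real^'d \<Rightarrow> real^'m \<Rightarrow> real \<Rightarrow> real^'d) \<Rightarrow> bool" where
  "constraint_function a b f \<longleftrightarrow>
     C2_on (UNIV \<times> UNIV \<times> {a..b}) (\<lambda>(x, v, t). f x v t) \<and>
     (\<exists>M\<ge>0. \<forall>x1 x2 v. \<forall>t\<in>{a..b}. norm (f x1 v t - f x2 v t) \<le> M * norm (x1 - x2))"

definition lagrangian ::
  "real \<Rightarrow> real \<Rightarrow> (real^'d \<Rightarrow> real^'m \<Rightarrow> real \<Rightarrow> real) \<Rightarrow> bool" where
  "lagrangian a b L \<longleftrightarrow> C2_on (UNIV \<times> UNIV \<times> {a..b}) (\<lambda>(x, v, t). L x v t)"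

definition hamiltonian ::
  "(real^'d \<Rightarrow> real^'m \<Rightarrow> real \<Rightarrow> real) \<Rightarrow> (real^'d \<Rightarrow> real^'m \<Rightarrow> real \<Rightarrow> real^'d) \<Rightarrow>
   real^'d \<Rightarrow> real^'m \<Rightarrow> real^'d \<Rightarrow> real \<Rightarrow> real" where
  "hamiltonian L f x v w t = L x v t + w \<bullet> f x v t"

text \<open>The first two equations are required on the intervals on which the fractional derivatives
  are defined; their right-hand sides are continuous on \<open>[a,b]\<close>, so this is the same as equality
  in \<open>C\<^sup>0([a,b])\<close> after continuous extension.\<close>

definition pontryagin_solution ::
  "real \<Rightarrow> real \<Rightarrow> real \<Rightarrow> real^'d \<Rightarrow>
   (real^'d \<Rightarrow> real^'m \<Rightarrow> real^'d \<Rightarrow> real \<Rightarrow> real) \<Rightarrow>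
   (real \<Rightarrow> real^'d) \<Rightarrow> (real \<Rightarrow> real^'m) \<Rightarrow> (real \<Rightarrow> real^'d) \<Rightarrow> bool" where
  "pontryagin_solution \<alpha> a b A H q u p \<longleftrightarrow>
     Ck_curve a b (nat \<lfloor>\<alpha>\<rfloor>) q \<and> continuous_on {a..b} u \<and> Ck_curve a b (nat \<lfloor>\<alpha>\<rfloor>) p \<and>
     caputo_left_exists \<alpha> a b q \<and>
     (\<forall>t\<in>{a<..b}. GDERIV (\<lambda>w. H (q t) (u t) w t) (p t) :> caputo_left \<alpha> a b q t) \<and>
     RL_right_exists \<alpha> a b p \<and>
     (\<forall>t\<in>{a..<b}. GDERIV (\<lambda>x. H x (u t) (p t) t) (q t) :> RL_right \<alpha> a b p t) \<and>
     (\<forall>t\<in>{a..b}. GDERIV (\<lambda>v. H (q t) v (p t) t) (u t) :> 0) \<and>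
     q a = A \<and> p b = 0"


section \<open>Invariance and Condition (C)\<close>

definition diffeomorphism ::
  "('a::real_normed_vector \<Rightarrow> 'a) \<Rightarrow> bool" where
  "diffeomorphism h \<longleftrightarrow> bij h \<and> C1_on UNIV h \<and> C1_on UNIV (inv h)"

definition one_param_group ::
  "(real \<Rightarrow> 'a::real_normed_vector \<Rightarrow> 'a) \<Rightarrow> bool" where
  "one_param_group \<phi> \<longleftrightarrow>
     (\<forall>s. diffeomorphism (\<phi> s)) \<and>
     \<phi> 0 = id \<and>
     (\<forall>s s'. \<phi> s \<circ> \<phi> s' = \<phi> (s + s')) \<and>
     C2_on UNIV (\<lambda>(s, x). \<phi> s x)"

definition caputo_invariant ::
  "real \<Rightarrow> real \<Rightarrow> real \<Rightarrow> real^'d \<Rightarrow>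
   (real^'d \<Rightarrow> real^'m \<Rightarrow> real^'d \<Rightarrow> real \<Rightarrow> real) \<Rightarrow>
   (real \<Rightarrow> real^'d \<Rightarrow> real^'d) \<Rightarrow> (real \<Rightarrow> real^'m \<Rightarrow> real^'m) \<Rightarrow>
   (real \<Rightarrow> real^'d \<Rightarrow> real^'d) \<Rightarrow> bool" where
  "caputo_invariant \<alpha> a b A H \<phi>1 \<phi>2 \<phi>3 \<longleftrightarrow>
     (\<forall>q u p s. pontryagin_solution \<alpha> a b A H q u p \<longrightarrow>
        caputo_left_exists \<alpha> a b (\<lambda>t. \<phi>1 s (q t)) \<and>
        (\<forall>t\<in>{a<..b}.
           H (\<phi>1 s (q t)) (\<phi>2 s (u t)) (\<phi>3 s (p t)) t
             - \<phi>3 s (p t) \<bullet> caputo_left \<alpha> a b (\<lambda>\<tau>. \<phi>1 s (q \<tau>)) t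
           = H (q t) (u t) (p t) t - p t \<bullet> caputo_left \<alpha> a b q t))"

text \<open>The sequences are indexed by \<open>n \<ge> 1\<close>, written as \<open>Suc n\<close>.\<close>

definition condition_C ::
  "real \<Rightarrow> real \<Rightarrow> real \<Rightarrow> (real \<Rightarrow> 'a::euclidean_space) \<Rightarrow> (real \<Rightarrow> 'a) \<Rightarrow> bool" where
  "condition_C \<alpha> a b g1 g2 \<longleftrightarrow>
     uniform_limit {a..b}
       (\<lambda>n t. frac_int_left (real (Suc n) - \<alpha>) a (\<lambda>y. g1 y - g1 a) t
                \<bullet> nth_deriv a b (Suc n) g2 t)
       (\<lambda>t. 0) sequentially \<and>
     uniform_limit {a..b}
       (\<lambda>n t. nth_deriv a b (Suc n) g1 t \<bullet> frac_int_right (real (Suc n) - \<alpha>) b g2 t)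
       (\<lambda>t. 0) sequentially"

end

theory Submission
  imports Defs
begin

text \<open>
  Write \<open>G = g - g(a)\<close>, and \<open>I\<^sub>-\<close>, \<open>I\<^sub>+\<close> for the left and right fractional integrals. The theorem
  combines a telescoping argument with a fractional Noether identity.

  \<^emph>\<open>Telescoping.\<close> Since \<open>G(a) = 0\<close> and \<open>p(b) = 0\<close>, lowering the order of \<open>I\<^sub>-\<close> on \<open>G\<close> and of
  \<open>I\<^sub>+\<close> on \<open>p\<close> by one is differentiation (up to a sign for \<open>I\<^sub>+\<close>) on all of \<open>[a,b]\<close>, as long as the
  lowered order is nonnegative (\<open>frac_int_left_has_vector_derivative\<close> and its mirror image). By the
  product rule, for \<open>r \<ge> 1\<close> each of the two halves of the \<open>r\<close>-th summand has as derivative the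
  difference of two consecutive members of a sequence that Condition (C) sends uniformly to \<open>0\<close>
  (up to signs that alternate with \<open>r\<close>). So the derivatives of the partial sums converge uniformly,
  to minus the first member. The series themselves converge because the left halves all vanish at
  \<open>a\<close> and the right halves all vanish at \<open>b\<close>: one point of convergence suffices
  (\<open>telescoping_series_has_derivative\<close>). It remains to see that the derivative of the summand
  \<open>r = 0\<close> cancels these two limits. Its right half has derivative
  \<open>g' \<bullet> I\<^sub>+\<^sup>1\<^sup>-\<^sup>\<alpha> p - g \<bullet> D\<^sub>+\<^sup>\<alpha> p\<close> by definition of \<open>D\<^sub>+\<^sup>\<alpha>\<close>, so the left half
  \<open>I\<^sub>-\<^sup>1\<^sup>-\<^sup>\<alpha> G \<bullet> p\<close> must have derivative \<open>I\<^sub>-\<^sup>1\<^sup>-\<^sup>\<alpha> G \<bullet> p' + g \<bullet> D\<^sub>+\<^sup>\<alpha> p\<close>.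

  \<^emph>\<open>Noether identity.\<close> Formally this is the invariance relation differentiated in \<open>s\<close> at \<open>s = 0\<close>,
  where the Pontryagin equations identify the three partial gradients of the Hamiltonian. The
  delicate point is to differentiate the Caputo derivative of \<open>\<phi>\<^sub>1(s, q)\<close> with respect to \<open>s\<close>: for
  \<open>\<alpha> < 1\<close> the curve \<open>q\<close> is merely continuous, so there is no direct control over its
  \<open>s\<close>-difference quotients. What is under control are the fractional integrals \<open>I\<^sub>s\<close> of
  \<open>\<phi>\<^sub>1(s, q) - \<phi>\<^sub>1(s, q(a))\<close>, whose difference quotients converge uniformly. Moreover
  \<open>P\<^sub>s = \<phi>\<^sub>3(s, p)\<close> is \<open>C\<^sup>1\<close> in \<open>t\<close>, because \<open>p\<close> is smooth. Consider therefore \<open>P\<^sub>s \<bullet> I\<^sub>s\<close>. Its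
  \<open>t\<close>-derivative is \<open>P\<^sub>s' \<bullet> I\<^sub>s + P\<^sub>s \<bullet> W\<^sub>s\<close>, with \<open>W\<^sub>s\<close> the Caputo derivative, and the invariance
  expresses the last product through the Hamiltonian, which is \<open>C\<^sup>1\<close> in \<open>s\<close>. So the
  \<open>s\<close>-difference quotients of \<open>P\<^sub>s \<bullet> I\<^sub>s\<close> converge uniformly together with their \<open>t\<close>-derivatives,
  and the two differentiations commute (\<open>param_deriv_commute\<close>). Removing the part of the resulting
  product rule that belongs to the flow \<open>\<phi>\<^sub>3\<close> leaves the claim (\<open>noether_first_term\<close>).
\<close>

section \<open>Fractional integrals of continuous curves\<close>

lemma powr_root_le_iff:
  fixes \<gamma> x z :: real
  assumes "0 < \<gamma>" "0 \<le> x" "0 \<le> z"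
  shows "z powr (1 / \<gamma>) \<le> x \<longleftrightarrow> z \<le> x powr \<gamma>"
proof
  assume "z powr (1 / \<gamma>) \<le> x"
  then have "(z powr (1 / \<gamma>)) powr \<gamma> \<le> x powr \<gamma>" using assms by (intro powr_mono2) auto
  then show "z \<le> x powr \<gamma>" using assms by (simp add: powr_powr)
next
  assume "z \<le> x powr \<gamma>"
  then have "z powr (1 / \<gamma>) \<le> (x powr \<gamma>) powr (1 / \<gamma>)" using assms by (intro powr_mono2) auto
  then show "z powr (1 / \<gamma>) \<le> x" using assms by (simp add: powr_powr)
qed

lemma continuous_on_powr_const:
  fixes f :: "'a::topological_space \<Rightarrow> real"
  assumes "continuous_on S f" "\<And>x. x \<in> S \<Longrightarrow> 0 \<le> f x" "0 < k"
  shows "continuous_on S (\<lambda>x. f x powr k)"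
  using assms by (intro continuous_on_powr') auto

text \<open>
  The substitution \<open>z = (t - y)\<^sup>\<gamma>\<close> absorbs the singular kernel: the right-hand side integrates a
  continuous function over a compact interval. Integrability, bounds and differentiation under the
  integral sign all come from this form.
\<close>

lemma abel_integral_substitution:
  fixes G :: "real \<Rightarrow> 'a::euclidean_space"
  assumes \<gamma>: "0 < \<gamma>" and t: "a \<le> t" and G: "continuous_on {a..t} G"
  shows "((\<lambda>y. (t - y) powr (\<gamma> - 1) *\<^sub>R G y) has_integral
      (1 / \<gamma>) *\<^sub>R integral {0..(t - a) powr \<gamma>} (\<lambda>z. G (t - z powr (1 / \<gamma>)))) {a..t}"
proof -
  let ?f = "\<lambda>z. G (t - z powr (1 / \<gamma>))"
  let ?h = "\<lambda>y. (t - y) powr \<gamma>"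
  let ?T = "(t - a) powr \<gamma>"
  have rng: "a \<le> t - z powr (1 / \<gamma>)" if "z \<in> {0..?T}" for z
    using powr_root_le_iff[of \<gamma> "t - a" z] that \<gamma> t by auto
  have cf: "continuous_on {0..?T} ?f"
    using rng \<gamma> by (intro continuous_on_compose2[OF G] continuous_intros continuous_on_powr_const) auto
  have ch: "continuous_on {a..t} ?h"
    using \<gamma> by (intro continuous_intros continuous_on_powr_const) auto
  have sub: "?h ` {a..t} \<subseteq> {0..?T}"
    using \<gamma> by (auto intro!: powr_mono2)
  have inv: "?f (?h y) = G y" if "y \<in> {a..t}" for y
    using that \<gamma> by (simp add: powr_powr)
  \<comment> \<open>The substitution is not differentiable at \<open>y = t\<close> when \<open>\<gamma> < 1\<close>; that point is exempted.\<close>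
  have "((\<lambda>y. (- \<gamma> * (t - y) powr (\<gamma> - 1)) *\<^sub>R ?f (?h y)) has_integral
      (integral {?h a..?h t} ?f - integral {?h t..?h a} ?f)) {a..t}"
  proof (rule has_integral_substitution_general[OF _ t sub cf ch, of "{t}"])
    fix y assume "y \<in> {a..t} - {t}"
    then show "(?h has_field_derivative - \<gamma> * (t - y) powr (\<gamma> - 1)) (at y within {a..t})"
      by (auto intro!: derivative_eq_intros simp: powr_diff field_simps)
  qed simp
  moreover have "integral {?h a..?h t} ?f = 0"
    using \<gamma> t by (intro integral_unique has_integral_null_eq[THEN iffD2] refl)
      (auto simp: content_real_eq_0)
  ultimately have "((\<lambda>y. (- \<gamma> * (t - y) powr (\<gamma> - 1)) *\<^sub>R ?f (?h y)) has_integral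
      - integral {0..?T} ?f) {a..t}"
    using \<gamma> by simp
  from has_integral_cmul[OF this, of "- 1 / \<gamma>"]
  have "((\<lambda>y. (- 1 / \<gamma>) *\<^sub>R ((- \<gamma> * (t - y) powr (\<gamma> - 1)) *\<^sub>R ?f (?h y))) has_integral
      (1 / \<gamma>) *\<^sub>R integral {0..?T} ?f) {a..t}"
    by simp
  then show ?thesis
    by (rule has_integral_eq[rotated]) (use \<gamma> inv in simp)
qed

lemma frac_int_left_substitution:
  fixes G :: "real \<Rightarrow> 'a::euclidean_space"
  assumes "0 < \<gamma>" "a \<le> t" "continuous_on {a..t} G"
  shows "frac_int_left \<gamma> a G t =
    (1 / Gamma (\<gamma> + 1)) *\<^sub>R integral {0..(t - a) powr \<gamma>} (\<lambda>z. G (t - z powr (1 / \<gamma>)))"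
proof -
  have "Gamma (\<gamma> + 1) = \<gamma> * Gamma \<gamma>"
    using assms(1) by (intro Gamma_plus1) (auto elim: nonpos_Ints_cases)
  then show ?thesis
    using integral_unique[OF abel_integral_substitution[OF assms]] assms(1)
    by (simp add: frac_int_left_def)
qed

text \<open>
  The bound does not depend on \<open>t\<close>, so that the fractional integral preserves uniform convergence.
\<close>

lemma norm_frac_int_left_le:
  fixes G :: "real \<Rightarrow> 'a::euclidean_space"
  assumes \<beta>: "0 \<le> \<beta>" and t: "t \<in> {a..b}" and G: "continuous_on {a..b} G"
    and B: "\<And>y. y \<in> {a..b} \<Longrightarrow> norm (G y) \<le> B"
  shows "norm (frac_int_left \<beta> a G t) \<le> (if \<beta> = 0 then 1 else (b - a) powr \<beta> / Gamma (\<beta> + 1)) * B"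
proof (cases "\<beta> = 0")
  case True
  then show ?thesis using B t by (simp add: frac_int_left_def)
next
  case False
  with \<beta> have \<beta>: "0 < \<beta>" by simp
  let ?f = "\<lambda>z. G (t - z powr (1 / \<beta>))"
  let ?T = "(t - a) powr \<beta>"
  have Gt: "continuous_on {a..t} G" using G t by (auto intro: continuous_on_subset)
  have rng: "a \<le> t - z powr (1 / \<beta>)" if "z \<in> {0..?T}" for z
    using powr_root_le_iff[of \<beta> "t - a" z] that \<beta> t by auto
  have cf: "continuous_on {0..?T} ?f"
    using rng \<beta> by (intro continuous_on_compose2[OF Gt] continuous_intros continuous_on_powr_const) auto
  have "norm (integral {0..?T} ?f) \<le> B * (?T - 0)"
  proof (rule integral_bound[OF _ cf])
    fix z assume "z \<in> {0..?T}"
    with rng[OF this] show "norm (?f z) \<le> B"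
      using t by (intro B) (auto intro: order_trans[of _ t])
  qed simp
  also have "\<dots> \<le> B * (b - a) powr \<beta>"
    using t \<beta> order_trans[OF norm_ge_zero B[OF t]] by (auto intro!: mult_left_mono powr_mono2)
  finally have "norm (integral {0..?T} ?f) \<le> B * (b - a) powr \<beta>" .
  moreover have "Gamma (\<beta> + 1) > 0" using \<beta> by (intro Gamma_real_pos) auto
  ultimately have "norm (integral {0..?T} ?f) / Gamma (\<beta> + 1) \<le> B * (b - a) powr \<beta> / Gamma (\<beta> + 1)"
    by (intro divide_right_mono) auto
  then show ?thesis
    using \<beta> t Gt \<open>Gamma (\<beta> + 1) > 0\<close> by (simp add: frac_int_left_substitution mult_ac)
qed

lemma frac_int_left_linear:
  fixes F G :: "real \<Rightarrow> 'a::euclidean_space"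
  assumes \<beta>: "0 \<le> \<beta>" and t: "a \<le> t" and F: "continuous_on {a..t} F" and G: "continuous_on {a..t} G"
  shows "frac_int_left \<beta> a (\<lambda>y. k *\<^sub>R (F y - G y)) t
    = k *\<^sub>R (frac_int_left \<beta> a F t - frac_int_left \<beta> a G t)"
proof (cases "\<beta> = 0")
  case True
  then show ?thesis by (simp add: frac_int_left_def)
next
  case False
  with \<beta> have \<beta>: "0 < \<beta>" by simp
  let ?w = "\<lambda>y. (t - y) powr (\<beta> - 1)"
  have F': "(\<lambda>y. ?w y *\<^sub>R F y) integrable_on {a..t}" and G': "(\<lambda>y. ?w y *\<^sub>R G y) integrable_on {a..t}"
    using abel_integral_substitution[OF \<beta> t] F G by blast+
  have "integral {a..t} (\<lambda>y. ?w y *\<^sub>R (k *\<^sub>R (F y - G y)))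
      = integral {a..t} (\<lambda>y. k *\<^sub>R (?w y *\<^sub>R F y - ?w y *\<^sub>R G y))"
    by (simp add: scaleR_diff_right mult.commute)
  also have "\<dots> = k *\<^sub>R (integral {a..t} (\<lambda>y. ?w y *\<^sub>R F y) - integral {a..t} (\<lambda>y. ?w y *\<^sub>R G y))"
    by (simp only: integral_cmul integral_diff[OF F' G'])
  finally show ?thesis using \<beta> by (simp add: frac_int_left_def scaleR_diff_right)
qed

text \<open>
  Integration by parts moves one order of integration from the kernel to \<open>G\<close>. The boundary terms
  vanish, the kernel being \<open>0\<close> at \<open>y = t\<close> and the primitive being \<open>0\<close> at \<open>y = a\<close>.
\<close>

lemma frac_int_left_Suc_primitive:
  fixes G :: "real \<Rightarrow> 'a::euclidean_space"
  assumes \<gamma>: "0 < \<gamma>" and t: "a \<le> t" and G: "continuous_on {a..t} G"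
  shows "frac_int_left (\<gamma> + 1) a G t = frac_int_left \<gamma> a (\<lambda>y. integral {a..y} G) t"
proof -
  let ?N = "\<lambda>y. integral {a..y} G"
  have cN: "continuous_on {a..t} ?N"
    by (intro indefinite_integral_continuous_1 integrable_continuous_real G)
  have int: "(\<lambda>y. (t - y) powr \<gamma> *\<^sub>R G y) integrable_on {a..t}"
    using abel_integral_substitution[of "\<gamma> + 1" a t G] \<gamma> t G by auto
  let ?I = "integral {a..t} (\<lambda>y. (t - y) powr \<gamma> *\<^sub>R G y)"
  have "((\<lambda>y. (- \<gamma> * (t - y) powr (\<gamma> - 1)) *\<^sub>R ?N y) has_integral - ?I) {a..t}"
  proof (rule integration_by_parts_interior[OF bounded_bilinear_scaleR t _ cN])
    show "continuous_on {a..t} (\<lambda>y. (t - y) powr \<gamma>)"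
      using \<gamma> by (intro continuous_intros continuous_on_powr_const) auto
    fix y assume y: "y \<in> {a<..<t}"
    show "((\<lambda>y. (t - y) powr \<gamma>) has_vector_derivative - \<gamma> * (t - y) powr (\<gamma> - 1)) (at y)"
      using y unfolding has_real_derivative_iff_has_vector_derivative[symmetric]
      by (auto intro!: derivative_eq_intros simp: powr_diff field_simps)
    show "(?N has_vector_derivative G y) (at y)"
      using integral_has_vector_derivative[OF G, of y] y by (simp add: at_within_Icc_at)
  next
    show "((\<lambda>x. (t - x) powr \<gamma> *\<^sub>R G x) has_integral
     (t - t) powr \<gamma> *\<^sub>R ?N t - (t - a) powr \<gamma> *\<^sub>R ?N a - - ?I) {a..t}"
      using int \<gamma> by (simp add: has_integral_integral[symmetric])
  qed
  from has_integral_cmul[OF this, of "- 1 / \<gamma>"]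
  have "((\<lambda>y. (t - y) powr (\<gamma> - 1) *\<^sub>R ?N y) has_integral (1 / \<gamma>) *\<^sub>R ?I) {a..t}"
    using \<gamma> by simp
  moreover have "Gamma (\<gamma> + 1) = \<gamma> * Gamma \<gamma>"
    using \<gamma> by (intro Gamma_plus1) (auto elim: nonpos_Ints_cases)
  ultimately show ?thesis
    using \<gamma> by (simp add: frac_int_left_def integral_unique)
qed

text \<open>
  After one integration by parts, the kernel has to be kept and the primitive of \<open>G\<close> to be
  differentiated under the integral sign. The substituted form has a domain of integration that
  still depends on \<open>t\<close>; extending \<open>G\<close> by \<open>0\<close> to the left of \<open>a\<close>, which keeps it continuous because
  \<open>G a = 0\<close>, turns it into an integral over a fixed interval, to which the Leibniz rule applies.
\<close>

lemma frac_int_left_has_vector_derivative: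
  fixes G :: "real \<Rightarrow> 'a::euclidean_space"
  assumes \<gamma>: "0 \<le> \<gamma>" and t: "t \<in> {a..b}" and G: "continuous_on {a..b} G" and G0: "G a = 0"
  shows "(frac_int_left (\<gamma> + 1) a G has_vector_derivative frac_int_left \<gamma> a G t) (at t within {a..b})"
proof (cases "\<gamma> = 0")
  case True
  have eq: "frac_int_left 1 a G x = integral {a..x} G" for x
  proof -
    \<comment> \<open>The convention \<open>0 powr 0 = 0\<close> changes the integrand at \<open>y = x\<close> only.\<close>
    have "integral {a..x} (\<lambda>y. (x - y) powr 0 *\<^sub>R G y) = integral {a..x} G"
      by (rule integral_spike[of "{x}"]) auto
    then show ?thesis by (simp add: frac_int_left_def)
  qed
  then have "frac_int_left 1 a G = (\<lambda>x. integral {a..x} G)" by auto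
  then show ?thesis
    using True integral_has_vector_derivative[OF G t] by (simp add: frac_int_left_def)
next
  case False
  with \<gamma> have \<gamma>: "0 < \<gamma>" by simp
  \<comment> \<open>The arguments \<open>t - z powr (1 / \<gamma>)\<close> with \<open>t \<in> {a..b}\<close> and \<open>z \<in> {0..T}\<close> fill \<open>{c..b}\<close>.\<close>
  define T where "T = (b - a) powr \<gamma>"
  define c where "c = 2 * a - b"
  define G' where "G' = (\<lambda>y. G (max a y))"
  define N where "N = (\<lambda>y. integral {c..y} G')"
  have ab: "a \<le> b" and ca: "c \<le> a" using t by (auto simp: c_def)
  have cG': "continuous_on {c..b} G'"
    unfolding G'_def using ab by (intro continuous_on_compose2[OF G] continuous_intros) auto
  have G'0: "G' y = 0" if "y \<le> a" for y using that G0 by (simp add: G'_def max_def)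
  have N0: "N y = 0" if "y \<le> a" for y
    unfolding N_def using that G'0 by (intro integral_unique has_integral_is_0) auto
  have N_eq: "N y = integral {a..y} G" if "y \<in> {a..b}" for y
  proof -
    have "G' integrable_on {c..y}"
      using that cG' by (intro integrable_continuous_real) (auto intro: continuous_on_subset)
    then have "N y = integral {c..a} G' + integral {a..y} G'"
      unfolding N_def using ca that by (intro Henstock_Kurzweil_Integration.integral_combine[symmetric]) auto
    also have "integral {c..a} G' = 0" using N0[of a] by (simp add: N_def)
    also have "integral {a..y} G' = integral {a..y} G"
      by (intro integral_cong) (simp add: G'_def)
    finally show ?thesis by simp
  qed
  have dN: "(N has_vector_derivative G' y) (at y within {c..b})" if "y \<in> {c..b}" for y
    unfolding N_def using integral_has_vector_derivative[OF cG' that] .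
  have cN: "continuous_on {c..b} N"
    using dN by (rule continuous_on_vector_derivative)
  have rng: "x - z powr (1 / \<gamma>) \<in> {c..b}" if "x \<in> {a..b}" "z \<in> {0..T}" for x z
  proof -
    have "z powr (1 / \<gamma>) \<le> b - a"
      using powr_root_le_iff[of \<gamma> "b - a" z] that \<gamma> ab by (auto simp: T_def)
    moreover have "0 \<le> z powr (1 / \<gamma>)" by simp
    ultimately show ?thesis using that(1) unfolding c_def atLeastAtMost_iff by linarith
  qed
  have fixed_domain: "frac_int_left \<gamma> a M x = (1 / Gamma (\<gamma> + 1)) *\<^sub>R integral {0..T} (\<lambda>z. M' (x - z powr (1 / \<gamma>)))"
    if x: "x \<in> {a..b}" and M': "continuous_on {c..b} M'" and M0: "\<And>y. y \<le> a \<Longrightarrow> M' y = 0"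
      and M: "\<And>y. y \<in> {a..b} \<Longrightarrow> M y = M' y" for x and M M' :: "real \<Rightarrow> 'a"
  proof -
    let ?Tx = "(x - a) powr \<gamma>"
    let ?f = "\<lambda>z. M' (x - z powr (1 / \<gamma>))"
    have TT: "0 \<le> ?Tx" "?Tx \<le> T" using x \<gamma> by (auto simp: T_def intro!: powr_mono2)
    have z1: "a \<le> x - z powr (1 / \<gamma>)" if "z \<in> {0..?Tx}" for z
      using powr_root_le_iff[of \<gamma> "x - a" z] that \<gamma> x by auto
    have z2: "x - z powr (1 / \<gamma>) \<le> a" if "z \<in> {?Tx..T}" for z
    proof -
      have "?Tx powr (1 / \<gamma>) \<le> z powr (1 / \<gamma>)" using that \<gamma> by (intro powr_mono2) auto
      then show ?thesis using \<gamma> x by (simp add: powr_powr)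
    qed
    have cf: "continuous_on {0..T} ?f"
      using rng[OF x] \<gamma> by (intro continuous_on_compose2[OF M'] continuous_intros continuous_on_powr_const) auto
    have cM: "continuous_on {a..x} M"
    proof -
      have "continuous_on {a..x} M'" using M' ca x by (auto intro: continuous_on_subset)
      then show ?thesis by (rule continuous_on_eq) (use M x in auto)
    qed
    have "integral {0..T} ?f = integral {0..?Tx} ?f + integral {?Tx..T} ?f"
      using TT cf by (intro Henstock_Kurzweil_Integration.integral_combine[symmetric]
          integrable_continuous_real)
    also have "integral {?Tx..T} ?f = 0"
      using z2 M0 by (intro integral_unique has_integral_is_0) auto
    also have "integral {0..?Tx} ?f = integral {0..?Tx} (\<lambda>z. M (x - z powr (1 / \<gamma>)))"
    proof (rule integral_cong)
      fix z assume "z \<in> {0..?Tx}"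
      from z1[OF this] show "?f z = M (x - z powr (1 / \<gamma>))"
        using x by (intro M[symmetric]) (auto intro: order_trans[of _ x])
    qed
    finally show ?thesis using frac_int_left_substitution[OF \<gamma> _ cM] x by simp
  qed
  have eqN: "frac_int_left (\<gamma> + 1) a G x = (1 / Gamma (\<gamma> + 1)) *\<^sub>R integral {0..T} (\<lambda>z. N (x - z powr (1 / \<gamma>)))"
    if x: "x \<in> {a..b}" for x
  proof -
    have "frac_int_left (\<gamma> + 1) a G x = frac_int_left \<gamma> a (\<lambda>y. integral {a..y} G) x"
      using x G \<gamma> by (intro frac_int_left_Suc_primitive) (auto intro: continuous_on_subset)
    also have "\<dots> = (1 / Gamma (\<gamma> + 1)) *\<^sub>R integral {0..T} (\<lambda>z. N (x - z powr (1 / \<gamma>)))"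
      using N_eq N0 by (intro fixed_domain x cN) auto
    finally show ?thesis .
  qed
  have eqG: "frac_int_left \<gamma> a G t = (1 / Gamma (\<gamma> + 1)) *\<^sub>R integral {0..T} (\<lambda>z. G' (t - z powr (1 / \<gamma>)))"
    using G'0 by (intro fixed_domain t cG') (auto simp: G'_def)
  have "((\<lambda>x. integral (cbox 0 T) (\<lambda>z. N (x - z powr (1 / \<gamma>)))) has_vector_derivative
      integral (cbox 0 T) (\<lambda>z. G' (t - z powr (1 / \<gamma>)))) (at t within {a..b})"
  proof (rule leibniz_rule_vector_derivative[OF _ _ _ t])
    fix x z :: real assume x: "x \<in> {a..b}" and z: "z \<in> cbox 0 T"
    have "((\<lambda>x. x - z powr (1 / \<gamma>)) has_vector_derivative 1) (at x within {a..b})"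
      by (auto intro!: derivative_eq_intros)
    moreover have "(N has_vector_derivative G' (x - z powr (1 / \<gamma>)))
        (at (x - z powr (1 / \<gamma>)) within (\<lambda>x. x - z powr (1 / \<gamma>)) ` {a..b})"
      using rng z x by (intro has_vector_derivative_within_subset[OF dN]) auto
    ultimately show "((\<lambda>x. N (x - z powr (1 / \<gamma>))) has_vector_derivative G' (x - z powr (1 / \<gamma>)))
        (at x within {a..b})"
      using vector_diff_chain_within by (force simp: o_def)
  next
    fix x assume x: "x \<in> {a..b}"
    show "(\<lambda>z. N (x - z powr (1 / \<gamma>))) integrable_on cbox 0 T"
      using rng[OF x] \<gamma> unfolding cbox_interval
      by (intro integrable_continuous_real continuous_on_compose2[OF cN] continuous_intros continuous_on_powr_const) auto
  next
    show "continuous_on ({a..b} \<times> cbox 0 T) (\<lambda>(x, z). G' (x - z powr (1 / \<gamma>)))"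
      using rng \<gamma> unfolding split_beta cbox_interval
      by (intro continuous_on_compose2[OF cG'] continuous_intros continuous_on_powr_const) auto
  qed simp
  then have "((\<lambda>x. (1 / Gamma (\<gamma> + 1)) *\<^sub>R integral {0..T} (\<lambda>z. N (x - z powr (1 / \<gamma>)))) has_vector_derivative
      frac_int_left \<gamma> a G t) (at t within {a..b})"
    unfolding eqG cbox_interval by (auto intro!: derivative_eq_intros)
  with t eqN show ?thesis
    by (rule has_vector_derivative_transform)
qed

lemma frac_int_right_reflect:
  "frac_int_right \<beta> b g t = frac_int_left \<beta> (- b) (\<lambda>y. g (- y)) (- t)"
proof -
  have "integral {- b..- t} (\<lambda>y. (- t - y) powr (\<beta> - 1) *\<^sub>R g (- y))
      = integral {t..b} (\<lambda>y. (y - t) powr (\<beta> - 1) *\<^sub>R g y)"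
    using Henstock_Kurzweil_Integration.integral_reflect_real[of b t "\<lambda>y. (y - t) powr (\<beta> - 1) *\<^sub>R g y"]
    by (simp add: minus_diff_commute)
  then show ?thesis by (simp add: frac_int_left_def frac_int_right_def)
qed

text \<open>The reflection \<open>t \<mapsto> - t\<close> reduces this to the left integral.\<close>

lemma frac_int_right_has_vector_derivative:
  fixes G :: "real \<Rightarrow> 'a::euclidean_space"
  assumes \<gamma>: "0 \<le> \<gamma>" and t: "t \<in> {a..b}" and G: "continuous_on {a..b} G" and G0: "G b = 0"
  shows "(frac_int_right (\<gamma> + 1) b G has_vector_derivative - frac_int_right \<gamma> b G t) (at t within {a..b})"
proof -
  have "continuous_on {- b..- a} (\<lambda>y. G (- y))"
    by (intro continuous_on_compose2[OF G] continuous_intros) auto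
  then have "(frac_int_left (\<gamma> + 1) (- b) (\<lambda>y. G (- y)) has_vector_derivative
      frac_int_right \<gamma> b G t) (at (- t) within {- b..- a})"
    unfolding frac_int_right_reflect using t G0 \<gamma>
    by (intro frac_int_left_has_vector_derivative) auto
  moreover have "((\<lambda>t. - t) has_vector_derivative - 1) (at t within {a..b})"
    by (auto intro!: derivative_eq_intros)
  moreover have "uminus ` {a..b} = {- b..- a}" by auto
  ultimately show ?thesis
    using vector_diff_chain_within[of uminus "- 1" t "{a..b}"]
    unfolding frac_int_right_reflect[abs_def] by (force simp: o_def)
qed

section \<open>Curves depending on a parameter\<close>

text \<open>
  The curves \<open>X s\<close> have \<open>D\<close> as derivative in \<open>s\<close> at \<open>s = 0\<close>, with difference quotients that converge
  uniformly in \<open>t \<in> K\<close>.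
\<close>

definition param_deriv :: "real set \<Rightarrow> (real \<Rightarrow> real \<Rightarrow> 'a::real_normed_vector) \<Rightarrow> (real \<Rightarrow> 'a) \<Rightarrow> bool" where
  "param_deriv K X D \<longleftrightarrow> uniform_limit K (\<lambda>s t. (X s t - X 0 t) /\<^sub>R s) D (at 0)"

lemma param_deriv_subset: "param_deriv K X D \<Longrightarrow> K' \<subseteq> K \<Longrightarrow> param_deriv K' X D"
  unfolding param_deriv_def by (rule uniform_limit_on_subset)

text \<open>
  Comparing increments only allows \<open>X\<close> and \<open>Y\<close> to differ by a curve independent of \<open>s\<close>, which is
  what the invariance relation provides.
\<close>

lemma param_deriv_cong:
  assumes "param_deriv K X D" "\<And>s t. t \<in> K \<Longrightarrow> Y s t - Y 0 t = X s t - X 0 t" "\<And>t. t \<in> K \<Longrightarrow> E t = D t"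
  shows "param_deriv K Y E"
proof -
  have "uniform_limit K (\<lambda>s t. (Y s t - Y 0 t) /\<^sub>R s) E (at 0) \<longleftrightarrow>
    uniform_limit K (\<lambda>s t. (X s t - X 0 t) /\<^sub>R s) D (at 0)"
    using assms by (intro uniform_limit_cong') auto
  then show ?thesis using assms unfolding param_deriv_def by simp
qed

lemma param_deriv_add:
  assumes "param_deriv K X D" "param_deriv K Y E"
  shows "param_deriv K (\<lambda>s t. X s t + Y s t) (\<lambda>t. D t + E t)"
proof -
  have "(X s t + Y s t - (X 0 t + Y 0 t)) /\<^sub>R s = (X s t - X 0 t) /\<^sub>R s + (Y s t - Y 0 t) /\<^sub>R s" for s t
    by (simp add: algebra_simps)
  then show ?thesis
    using assms unfolding param_deriv_def by (simp add: uniform_limit_add)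
qed

lemma param_deriv_inner:
  fixes X Y :: "real \<Rightarrow> real \<Rightarrow> 'a::real_inner"
  assumes X: "param_deriv K X D" and Y: "param_deriv K Y E"
    and bdd: "bounded (X 0 ` K)" "bounded (Y 0 ` K)" "bounded (D ` K)" "bounded (E ` K)"
  shows "param_deriv K (\<lambda>s t. X s t \<bullet> Y s t) (\<lambda>t. D t \<bullet> Y 0 t + X 0 t \<bullet> E t)"
proof -
  let ?x = "\<lambda>s t. (X s t - X 0 t) /\<^sub>R s" and ?y = "\<lambda>s t. (Y s t - Y 0 t) /\<^sub>R s"
  have bdd2: "bounded ((\<lambda>t. D t \<bullet> E t) ` K)"
  proof -
    from bdd(3,4) obtain M N where M: "\<And>t. t \<in> K \<Longrightarrow> norm (D t) \<le> M"
      and N: "\<And>t. t \<in> K \<Longrightarrow> norm (E t) \<le> N"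
      unfolding bounded_iff by auto
    have "norm (D t \<bullet> E t) \<le> M * N" if "t \<in> K" for t
    proof -
      have "norm (D t \<bullet> E t) \<le> norm (D t) * norm (E t)" using Cauchy_Schwarz_ineq2 by simp
      also have "\<dots> \<le> M * N"
        using order_trans[OF norm_ge_zero M[OF that]] by (intro mult_mono M N that) auto
      finally show ?thesis .
    qed
    then show ?thesis unfolding bounded_iff by auto
  qed
  have s: "uniform_limit K (\<lambda>s t. s) (\<lambda>t. 0::real) (at 0)"
    by (auto intro!: uniform_limitI simp: eventually_at)
  \<comment> \<open>The difference quotient of the product, written in terms of the difference quotients of its factors.\<close>
  have "uniform_limit K (\<lambda>s t. ?x s t \<bullet> Y 0 t + X 0 t \<bullet> ?y s t + s * (?x s t \<bullet> ?y s t))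
      (\<lambda>t. D t \<bullet> Y 0 t + X 0 t \<bullet> E t + 0 * (D t \<bullet> E t)) (at 0)"
    using X Y unfolding param_deriv_def
    by (intro uniform_limit_intros s bdd bdd2) (auto simp: bounded_iff)
  moreover have "eventually (\<lambda>s. \<forall>t\<in>K. ?x s t \<bullet> Y 0 t + X 0 t \<bullet> ?y s t + s * (?x s t \<bullet> ?y s t)
      = (X s t \<bullet> Y s t - X 0 t \<bullet> Y 0 t) /\<^sub>R s) (at 0)"
    unfolding eventually_at
    by (intro exI[of _ 1]) (auto simp: inner_diff_left inner_diff_right field_simps)
  ultimately show ?thesis
    unfolding param_deriv_def by (simp add: uniform_limit_cong)
qed

lemma param_deriv_frac_int_left:
  fixes X :: "real \<Rightarrow> real \<Rightarrow> 'a::euclidean_space"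
  assumes \<beta>: "0 \<le> \<beta>" and X: "\<And>s. continuous_on {a..b} (X s)" and D: "continuous_on {a..b} D"
    and lim: "param_deriv {a..b} X D"
  shows "param_deriv {a..b} (\<lambda>s. frac_int_left \<beta> a (X s)) (frac_int_left \<beta> a D)"
  unfolding param_deriv_def
proof (rule uniform_limitI)
  fix e :: real assume e: "e > 0"
  let ?I = "frac_int_left \<beta> a"
  define C where "C = (if \<beta> = 0 then 1 else (b - a) powr \<beta> / Gamma (\<beta> + 1)) + 1"
  have "Gamma (\<beta> + 1) > 0" using \<beta> by (intro Gamma_real_pos) auto
  then have C: "C \<ge> 1" by (auto simp: C_def)
  have "\<forall>\<^sub>F s in at 0. \<forall>t\<in>{a..b}. dist ((X s t - X 0 t) /\<^sub>R s) (D t) < e / C"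
    using lim e C unfolding param_deriv_def by (intro uniform_limitD) auto
  then show "\<forall>\<^sub>F s in at 0. \<forall>t\<in>{a..b}. dist ((?I (X s) t - ?I (X 0) t) /\<^sub>R s) (?I D t) < e"
  proof eventually_elim
    case (elim s)
    let ?q = "\<lambda>y. inverse s *\<^sub>R (X s y - X 0 y)"
    have cq: "continuous_on {a..b} ?q" by (intro continuous_intros X)
    show ?case
    proof
      fix t assume t: "t \<in> {a..b}"
      have sub: "continuous_on {a..t} F" if "continuous_on {a..b} F" for F :: "real \<Rightarrow> 'a"
        using that t by (auto intro: continuous_on_subset)
      have "(?I (X s) t - ?I (X 0) t) /\<^sub>R s - ?I D t = ?I (\<lambda>y. 1 *\<^sub>R (?q y - D y)) t"
        using frac_int_left_linear[of \<beta> a t ?q D 1] frac_int_left_linear[of \<beta> a t "X s" "X 0" "inverse s"]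
          \<beta> t sub[OF X] sub[OF D] sub[OF cq] by simp
      also have "norm \<dots> \<le> (C - 1) * (e / C)"
      proof -
        have "norm (?I (\<lambda>y. 1 *\<^sub>R (?q y - D y)) t)
          \<le> (if \<beta> = 0 then 1 else (b - a) powr \<beta> / Gamma (\<beta> + 1)) * (e / C)"
        proof (rule norm_frac_int_left_le[OF \<beta> t])
          show "continuous_on {a..b} (\<lambda>y. 1 *\<^sub>R (?q y - D y))"
            by (intro continuous_intros cq D X)
          show "norm (1 *\<^sub>R (?q y - D y)) \<le> e / C" if "y \<in> {a..b}" for y
            using elim that by (auto simp: dist_norm less_imp_le)
        qed
        then show ?thesis by (simp add: C_def)
      qed
      also have "\<dots> < e" using C e by (simp add: field_simps)
      finally show "dist ((?I (X s) t - ?I (X 0) t) /\<^sub>R s) (?I D t) < e"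
        by (simp add: dist_norm)
    qed
  qed
qed

text \<open>
  Symmetry of mixed derivatives: the difference quotients in \<open>s\<close> converge and so do, uniformly, their \<open>t\<close>-derivatives, hence the limit is differentiable with the limit derivative.
\<close>

lemma param_deriv_commute:
  fixes X :: "real \<Rightarrow> real \<Rightarrow> 'a::banach"
  assumes K: "convex K" and t: "t \<in> K"
    and X: "\<And>s t. t \<in> K \<Longrightarrow> (X s has_vector_derivative X' s t) (at t within K)"
    and Y: "param_deriv K X Y" and Y': "param_deriv K X' Y'"
  shows "(Y has_vector_derivative Y' t) (at t within K)"
proof -
  define \<sigma> where "\<sigma> = (\<lambda>n. inverse (real (Suc n)))"
  have \<sigma>: "filterlim \<sigma> (at 0) sequentially"
    unfolding \<sigma>_def using LIMSEQ_inverse_real_of_nat by (auto simp: filterlim_at)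
  define x where "x = (\<lambda>n t. (X (\<sigma> n) t - X 0 t) /\<^sub>R \<sigma> n)"
  define x' where "x' = (\<lambda>n t. (X' (\<sigma> n) t - X' 0 t) /\<^sub>R \<sigma> n)"
  have lim: "uniform_limit K x Y sequentially" and lim': "uniform_limit K x' Y' sequentially"
    using filterlim_compose[OF Y[unfolded param_deriv_def] \<sigma>]
      filterlim_compose[OF Y'[unfolded param_deriv_def] \<sigma>]
    by (simp_all add: x_def x'_def)
  have "\<exists>g. \<forall>t\<in>K. (\<lambda>n. x n t) \<longlonglongrightarrow> g t \<and> (g has_derivative (\<lambda>h. h *\<^sub>R Y' t)) (at t within K)"
  proof (rule has_derivative_sequence[OF K _ _ t])
    fix n t assume "t \<in> K"
    then have "(x n has_vector_derivative x' n t) (at t within K)"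
      unfolding x_def x'_def by (auto intro!: derivative_eq_intros X)
    then show "(x n has_derivative (\<lambda>h. h *\<^sub>R x' n t)) (at t within K)"
      by (simp add: has_vector_derivative_def)
  next
    fix e :: real assume "e > 0"
    from uniform_limitD[OF lim' this]
    show "\<forall>\<^sub>F n in sequentially. \<forall>t\<in>K. \<forall>h. norm (h *\<^sub>R x' n t - h *\<^sub>R Y' t) \<le> e * norm h"
    proof eventually_elim
      case (elim n)
      show ?case
      proof (intro ballI allI)
        fix t h assume "t \<in> K"
        with elim have "norm (x' n t - Y' t) \<le> e" by (auto simp: dist_norm less_imp_le)
        then show "norm (h *\<^sub>R x' n t - h *\<^sub>R Y' t) \<le> e * norm h"
          unfolding scaleR_diff_right[symmetric] norm_scaleR by (subst mult.commute) (simp add: mult_right_mono)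
      qed
    qed
  next
    show "(\<lambda>n. x n t) \<longlonglongrightarrow> Y t" using tendsto_uniform_limitI[OF lim t] .
  qed
  then obtain g where g: "\<And>t. t \<in> K \<Longrightarrow> (\<lambda>n. x n t) \<longlonglongrightarrow> g t"
    "\<And>t. t \<in> K \<Longrightarrow> (g has_vector_derivative Y' t) (at t within K)"
    by (auto simp: has_vector_derivative_def)
  have "Y t = g t" if "t \<in> K" for t
    using tendsto_uniform_limitI[OF lim that] g(1)[OF that] by (rule LIMSEQ_unique)
  then show ?thesis using has_vector_derivative_transform[OF t _ g(2)[OF t]] by blast
qed

text \<open>
  The regularity in \<open>s\<close> that the data of the problem have along a continuous curve. Joint continuity
  with \<open>t\<close> is what makes the difference quotients converge uniformly on compact sets.
\<close>

definition param_C1 :: "real set \<Rightarrow> (real \<Rightarrow> real \<Rightarrow> 'a::real_normed_vector) \<Rightarrow> (real \<Rightarrow> real \<Rightarrow> 'a) \<Rightarrow> bool" where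
  "param_C1 K X X' \<longleftrightarrow>
     (\<forall>s. \<forall>t\<in>K. ((\<lambda>s. X s t) has_vector_derivative X' s t) (at s)) \<and>
     continuous_on (UNIV \<times> K) (\<lambda>z. X (fst z) (snd z)) \<and>
     continuous_on (UNIV \<times> K) (\<lambda>z. X' (fst z) (snd z))"

lemma param_C1_slice:
  assumes "param_C1 K X X'"
  shows "continuous_on K (X s)" "continuous_on K (X' s)"
proof -
  have X: "continuous_on (UNIV \<times> K) (\<lambda>z. X (fst z) (snd z))"
    and X': "continuous_on (UNIV \<times> K) (\<lambda>z. X' (fst z) (snd z))"
    using assms by (auto simp: param_C1_def)
  have s: "continuous_on K (Pair s)" "Pair s ` K \<subseteq> UNIV \<times> K" by (auto intro!: continuous_intros)
  show "continuous_on K (X s)" "continuous_on K (X' s)"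
    using continuous_on_compose2[OF X s] continuous_on_compose2[OF X' s] by simp_all
qed

lemma param_C1_imp_param_deriv:
  assumes K: "compact K" and X: "param_C1 K X X'"
  shows "param_deriv K X (X' 0)"
  unfolding param_deriv_def
proof (rule uniform_limitI)
  fix e :: real assume e: "e > 0"
  let ?S = "{-1..1::real} \<times> K"
  have "uniformly_continuous_on ?S (\<lambda>z. X' (fst z) (snd z))"
    using X unfolding param_C1_def
    by (intro compact_uniformly_continuous compact_Times K)
      (auto intro: continuous_on_subset)
  then obtain d where d: "d > 0" and
    dX: "\<And>z z'. z \<in> ?S \<Longrightarrow> z' \<in> ?S \<Longrightarrow> dist z' z < d \<Longrightarrow> dist (X' (fst z') (snd z')) (X' (fst z) (snd z)) < e / 2"
    unfolding uniformly_continuous_on_def using e by (metis half_gt_zero)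
  have "dist ((X s t - X 0 t) /\<^sub>R s) (X' 0 t) < e"
    if s: "s \<noteq> 0" "dist s 0 < min d 1" and t: "t \<in> K" for s t
  proof -
    have near: "norm (X' r t - X' 0 t) \<le> e / 2" if r: "r \<in> closed_segment 0 s" for r
    proof -
      have r: "\<bar>r\<bar> \<le> \<bar>s\<bar>" using r by (auto simp: closed_segment_eq_real_ivl split: if_splits)
      have "(0, t) \<in> ?S" "(r, t) \<in> ?S" "dist (r, t) (0, t) < d"
        using r s t by (auto simp: dist_Pair_Pair)
      from dX[OF this] have "dist (X' r t) (X' 0 t) < e / 2" by simp
      then show ?thesis by (simp add: dist_norm)
    qed
    have "norm (X s t - X 0 t - (s - 0) *\<^sub>R X' 0 t) \<le> norm (s - 0) * (e / 2)"
    proof (rule vector_differentiable_bound_linearization[where S = "closed_segment 0 s" and ?x0.0 = 0 and f' = "\<lambda>r. X' r t"])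
      show "((\<lambda>s. X s t) has_vector_derivative X' r t) (at r within closed_segment 0 s)" for r
        using X t unfolding param_C1_def by (auto intro: has_vector_derivative_at_within)
    qed (use near in auto)
    moreover have "(X s t - X 0 t) /\<^sub>R s - X' 0 t = (X s t - X 0 t - s *\<^sub>R X' 0 t) /\<^sub>R s"
      using s by (simp add: scaleR_diff_right)
    ultimately have "norm ((X s t - X 0 t) /\<^sub>R s - X' 0 t) \<le> e / 2"
      using s by (simp add: divide_simps mult_ac)
    then show ?thesis using e by (simp add: dist_norm)
  qed
  then show "\<forall>\<^sub>F s in at 0. \<forall>t\<in>K. dist ((X s t - X 0 t) /\<^sub>R s) (X' 0 t) < e"
    unfolding eventually_at using d by (intro exI[of _ "min d 1"]) auto
qed

lemma param_C1_const: "continuous_on K c \<Longrightarrow> param_C1 K (\<lambda>s. c) (\<lambda>s t. 0)"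
  unfolding param_C1_def
  by (auto intro!: continuous_intros elim!: continuous_on_compose2)

lemma param_C1_param: "param_C1 K (\<lambda>s t. s) (\<lambda>s t. 1)"
  unfolding param_C1_def by (auto intro!: continuous_intros derivative_eq_intros)

lemma param_C1_Pair:
  "param_C1 K X X' \<Longrightarrow> param_C1 K Y Y' \<Longrightarrow> param_C1 K (\<lambda>s t. (X s t, Y s t)) (\<lambda>s t. (X' s t, Y' s t))"
  unfolding param_C1_def by (auto intro!: continuous_intros has_vector_derivative_Pair)

lemma param_C1_add:
  "param_C1 K X X' \<Longrightarrow> param_C1 K Y Y' \<Longrightarrow> param_C1 K (\<lambda>s t. X s t + Y s t) (\<lambda>s t. X' s t + Y' s t)"
  unfolding param_C1_def by (auto intro!: continuous_intros derivative_intros)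

lemma param_C1_diff:
  "param_C1 K X X' \<Longrightarrow> param_C1 K Y Y' \<Longrightarrow> param_C1 K (\<lambda>s t. X s t - Y s t) (\<lambda>s t. X' s t - Y' s t)"
  unfolding param_C1_def by (auto intro!: continuous_intros derivative_intros)

lemma param_C1_bilinear:
  assumes "bounded_bilinear B" "param_C1 K X X'" "param_C1 K Y Y'"
  shows "param_C1 K (\<lambda>s t. B (X s t) (Y s t)) (\<lambda>s t. B (X s t) (Y' s t) + B (X' s t) (Y s t))"
  using assms unfolding param_C1_def
  by (auto intro!: continuous_intros bounded_bilinear.continuous_on[OF assms(1)]
      bounded_bilinear.has_vector_derivative[OF assms(1)])

text \<open>
  Chain rule for a map differentiable relative to \<open>S\<close> only, as are the Lagrangian and the constraint
  function, which live on times in \<open>[a,b]\<close>.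
\<close>

lemma param_C1_compose:
  assumes F: "\<And>x. x \<in> S \<Longrightarrow> (f has_derivative blinfun_apply (F x)) (at x within S)"
    and cF: "continuous_on S F" and X: "param_C1 K X X'" and S: "\<And>s t. t \<in> K \<Longrightarrow> X s t \<in> S"
  shows "param_C1 K (\<lambda>s t. f (X s t)) (\<lambda>s t. F (X s t) (X' s t))"
  unfolding param_C1_def
proof (intro conjI ballI allI)
  have cf: "continuous_on S f" using F by (rule has_derivative_continuous_on)
  show "continuous_on (UNIV \<times> K) (\<lambda>z. f (X (fst z) (snd z)))"
    using X S unfolding param_C1_def by (intro continuous_on_compose2[OF cf]) auto
  have "continuous_on (UNIV \<times> K) (\<lambda>z. F (X (fst z) (snd z)))"
    using X S unfolding param_C1_def by (intro continuous_on_compose2[OF cF]) auto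
  then show "continuous_on (UNIV \<times> K) (\<lambda>z. F (X (fst z) (snd z)) (X' (fst z) (snd z)))"
    using X unfolding param_C1_def by (intro continuous_intros) auto
  fix s t assume t: "t \<in> K"
  have "((\<lambda>s. X s t) has_derivative (\<lambda>h. h *\<^sub>R X' s t)) (at s)"
    using X t unfolding param_C1_def has_vector_derivative_def by auto
  moreover have "(f has_derivative F (X s t)) (at (X s t) within range (\<lambda>s. X s t))"
    using S t by (intro has_derivative_subset[OF F]) auto
  ultimately have "((\<lambda>s. f (X s t)) has_derivative (\<lambda>h. F (X s t) (h *\<^sub>R X' s t))) (at s)"
    using has_derivative_in_compose by blast
  then show "((\<lambda>s. f (X s t)) has_vector_derivative F (X s t) (X' s t)) (at s)"
    by (simp add: has_vector_derivative_def blinfun.scaleR_right)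
qed

section \<open>Flows and Hamiltonians along curves\<close>

lemma C2_on_derivatives:
  assumes "C2_on S f"
  obtains F1 F2 where
    "\<And>x. x \<in> S \<Longrightarrow> (f has_derivative blinfun_apply (F1 x)) (at x within S)"
    "\<And>x. x \<in> S \<Longrightarrow> (F1 has_derivative blinfun_apply (F2 x)) (at x within S)"
    "continuous_on S F1" "continuous_on S F2"
proof -
  from assms obtain F1 F2 where F: "\<And>x. x \<in> S \<Longrightarrow> (f has_derivative blinfun_apply (F1 x)) (at x within S)"
    "\<And>x. x \<in> S \<Longrightarrow> (F1 has_derivative blinfun_apply (F2 x)) (at x within S)"
    "continuous_on S F2"
    unfolding C2_on_def by auto
  from F(2) have "continuous_on S F1" by (rule has_derivative_continuous_on)
  with F show ?thesis using that by blast
qed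

lemma param_C1_flow:
  fixes \<phi> :: "real \<Rightarrow> 'a::real_normed_vector \<Rightarrow> 'a"
  assumes \<phi>: "C2_on UNIV (\<lambda>(s, x). \<phi> s x)" and c: "continuous_on K c"
  obtains X' where "param_C1 K (\<lambda>s t. \<phi> s (c t)) X'"
    "X' 0 = (\<lambda>t. vector_derivative (\<lambda>s. \<phi> s (c t)) (at 0))"
proof -
  obtain F1 where F: "\<And>z. ((\<lambda>(s, x). \<phi> s x) has_derivative blinfun_apply (F1 z)) (at z)"
    and cF: "continuous_on UNIV F1"
    using C2_on_derivatives[OF \<phi>] by (metis UNIV_I)
  have 1: "param_C1 K (\<lambda>s t. case (s, c t) of (s, x) \<Rightarrow> \<phi> s x) (\<lambda>s t. F1 (s, c t) (1, 0))"
    by (rule param_C1_compose[OF _ cF]) (auto intro!: F param_C1_Pair param_C1_param param_C1_const c)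
  have 2: "((\<lambda>s. \<phi> s x) has_vector_derivative F1 (0, x) (1, 0)) (at 0)" for x
  proof -
    have "((\<lambda>s. (s, x)) has_vector_derivative (1, 0)) (at 0)"
      by (auto intro!: derivative_eq_intros)
    from vector_derivative_diff_chain_within[OF this, of "\<lambda>(s, x). \<phi> s x" "F1 (0, x)"]
    show ?thesis using has_derivative_at_withinI[OF F[of "(0, x)"]] by (simp add: o_def)
  qed
  have "(\<lambda>t. F1 (0, c t) (1, 0)) = (\<lambda>t. vector_derivative (\<lambda>s. \<phi> s (c t)) (at 0))"
    by (rule ext) (rule vector_derivative_at[OF 2, symmetric])
  with that[OF 1[unfolded prod.case]] show ?thesis by simp
qed

text \<open>
  Along a \<open>C\<^sup>1\<close> curve the velocity of the transported curve is \<open>C\<^sup>1\<close> in the parameter. This uses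
  the second derivative of the flow.
\<close>

lemma param_C1_flow_velocity:
  fixes \<phi> :: "real \<Rightarrow> 'a::real_normed_vector \<Rightarrow> 'a"
  assumes \<phi>: "C2_on UNIV (\<lambda>(s, x). \<phi> s x)"
    and c: "\<And>t. t \<in> K \<Longrightarrow> (c has_vector_derivative c' t) (at t within K)" and c': "continuous_on K c'"
  obtains P' P'' where "param_C1 K P' P''"
    "\<And>s t. t \<in> K \<Longrightarrow> ((\<lambda>t. \<phi> s (c t)) has_vector_derivative P' s t) (at t within K)"
proof -
  obtain F1 F2 where F: "\<And>z. ((\<lambda>(s, x). \<phi> s x) has_derivative blinfun_apply (F1 z)) (at z)"
    and F2: "\<And>z. (F1 has_derivative blinfun_apply (F2 z)) (at z)"
    and cF2: "continuous_on UNIV F2"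
    using C2_on_derivatives[OF \<phi>] by (metis UNIV_I)
  have cc: "continuous_on K c" using c by (rule continuous_on_vector_derivative)
  have 1: "param_C1 K (\<lambda>s t. F1 (s, c t)) (\<lambda>s t. F2 (s, c t) (1, 0))"
    by (rule param_C1_compose[OF _ cF2]) (auto intro!: F2 param_C1_Pair param_C1_param param_C1_const cc)
  have 2: "param_C1 K (\<lambda>s t. (0::real, c' t)) (\<lambda>s t. 0)"
    by (intro param_C1_const continuous_intros c')
  have "((\<lambda>t. \<phi> s (c t)) has_vector_derivative F1 (s, c t) (0, c' t)) (at t within K)" if t: "t \<in> K" for s t
  proof -
    have "((\<lambda>t. (s, c t)) has_vector_derivative (0, c' t)) (at t within K)"
      by (auto intro!: derivative_eq_intros has_vector_derivative_Pair c t)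
    from vector_derivative_diff_chain_within[OF this, of "\<lambda>(s, x). \<phi> s x" "F1 (s, c t)"]
    show ?thesis using has_derivative_at_withinI[OF F[of "(s, c t)"]] by (simp add: o_def)
  qed
  with that[OF param_C1_bilinear[OF bounded_bilinear_blinfun_apply 1 2]] show ?thesis by blast
qed

text \<open>
  The hypotheses on the Lagrangian and on the constraint function give a total derivative of the
  Hamiltonian, whereas Pontryagin's system speaks of partial gradients. The second property connects
  the two.
\<close>

lemma param_C1_hamiltonian:
  fixes L :: "real^'d \<Rightarrow> real^'m \<Rightarrow> real \<Rightarrow> real"
    and f :: "real^'d \<Rightarrow> real^'m \<Rightarrow> real \<Rightarrow> real^'d"
  assumes L: "lagrangian a b L" and f: "constraint_function a b f"
    and x: "param_C1 {a..b} x x'" and v: "param_C1 {a..b} v v'" and w: "param_C1 {a..b} w w'"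
  obtains E where "param_C1 {a..b} (\<lambda>s t. hamiltonian L f (x s t) (v s t) (w s t) t) E"
    "\<And>s t Dx Dv Dw. t \<in> {a..b} \<Longrightarrow>
      GDERIV (\<lambda>\<xi>. hamiltonian L f \<xi> (v s t) (w s t) t) (x s t) :> Dx \<Longrightarrow>
      GDERIV (\<lambda>\<eta>. hamiltonian L f (x s t) \<eta> (w s t) t) (v s t) :> Dv \<Longrightarrow>
      GDERIV (\<lambda>\<omega>. hamiltonian L f (x s t) (v s t) \<omega> t) (w s t) :> Dw \<Longrightarrow>
      E s t = x' s t \<bullet> Dx + v' s t \<bullet> Dv + w' s t \<bullet> Dw"
proof -
  let ?S = "UNIV \<times> UNIV \<times> {a..b} :: ((real^'d) \<times> (real^'m) \<times> real) set"
  let ?L = "\<lambda>(x, v, t). L x v t" and ?f = "\<lambda>(x, v, t). f x v t"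
  obtain L1 where L1: "\<And>z. z \<in> ?S \<Longrightarrow> (?L has_derivative blinfun_apply (L1 z)) (at z within ?S)"
    and cL: "continuous_on ?S L1"
    using C2_on_derivatives[OF L[unfolded lagrangian_def]] by metis
  obtain f1 where f1: "\<And>z. z \<in> ?S \<Longrightarrow> (?f has_derivative blinfun_apply (f1 z)) (at z within ?S)"
    and cf: "continuous_on ?S f1"
    using C2_on_derivatives[OF f[unfolded constraint_function_def, THEN conjunct1]] by metis
  let ?z = "\<lambda>s t. (x s t, v s t, t)" and ?z' = "\<lambda>s t. (x' s t, v' s t, 0::real)"
  have z: "param_C1 {a..b} ?z ?z'"
    by (intro param_C1_Pair x v param_C1_const continuous_intros)
  have Lz: "param_C1 {a..b} (\<lambda>s t. ?L (?z s t)) (\<lambda>s t. L1 (?z s t) (?z' s t))"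
    by (rule param_C1_compose[OF L1 cL z]) auto
  have fz: "param_C1 {a..b} (\<lambda>s t. ?f (?z s t)) (\<lambda>s t. f1 (?z s t) (?z' s t))"
    by (rule param_C1_compose[OF f1 cf z]) auto
  define E where "E = (\<lambda>s t. L1 (?z s t) (?z' s t) + (w s t \<bullet> f1 (?z s t) (?z' s t) + w' s t \<bullet> ?f (?z s t)))"
  have "param_C1 {a..b} (\<lambda>s t. ?L (?z s t) + w s t \<bullet> ?f (?z s t)) E"
    unfolding E_def by (intro param_C1_add Lz param_C1_bilinear[OF bounded_bilinear_inner w fz])
  then have 1: "param_C1 {a..b} (\<lambda>s t. hamiltonian L f (x s t) (v s t) (w s t) t) E"
    by (simp add: hamiltonian_def)
  have 2: "E s t = x' s t \<bullet> Dx + v' s t \<bullet> Dv + w' s t \<bullet> Dw"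
    if t: "t \<in> {a..b}"
      and Dx: "GDERIV (\<lambda>\<xi>. hamiltonian L f \<xi> (v s t) (w s t) t) (x s t) :> Dx"
      and Dv: "GDERIV (\<lambda>\<eta>. hamiltonian L f (x s t) \<eta> (w s t) t) (v s t) :> Dv"
      and Dw: "GDERIV (\<lambda>\<omega>. hamiltonian L f (x s t) (v s t) \<omega> t) (w s t) :> Dw"
    for s t Dx Dv Dw
  proof -
    let ?P = "?z s t"
    have P: "?P \<in> ?S" using t by auto
    have slice_x: "((\<lambda>\<xi>. (\<xi>, v s t, t)) has_derivative (\<lambda>h. (h, 0, 0))) (at (x s t))"
      by (intro has_derivative_Pair has_derivative_ident has_derivative_const)
    have slice_v: "((\<lambda>\<eta>. (x s t, \<eta>, t)) has_derivative (\<lambda>h. (0, h, 0))) (at (v s t))"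
      by (intro has_derivative_Pair has_derivative_ident has_derivative_const)
    have 1: "((\<lambda>\<xi>. ?L (\<xi>, v s t, t) + w s t \<bullet> ?f (\<xi>, v s t, t)) has_derivative
        (\<lambda>h. L1 ?P (h, 0, 0) + w s t \<bullet> f1 ?P (h, 0, 0))) (at (x s t))"
      using t by (intro has_derivative_add has_derivative_inner_right
          has_derivative_in_compose[OF slice_x, of ?L] has_derivative_in_compose[OF slice_x, of ?f]
          has_derivative_subset[OF L1] has_derivative_subset[OF f1]) auto
    have 2: "((\<lambda>\<eta>. ?L (x s t, \<eta>, t) + w s t \<bullet> ?f (x s t, \<eta>, t)) has_derivative
        (\<lambda>h. L1 ?P (0, h, 0) + w s t \<bullet> f1 ?P (0, h, 0))) (at (v s t))"
      using t by (intro has_derivative_add has_derivative_inner_right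
          has_derivative_in_compose[OF slice_v, of ?L] has_derivative_in_compose[OF slice_v, of ?f]
          has_derivative_subset[OF L1] has_derivative_subset[OF f1]) auto
    have 3: "((\<lambda>\<omega>. hamiltonian L f (x s t) (v s t) \<omega> t) has_derivative (\<lambda>h. h \<bullet> ?f ?P)) (at (w s t))"
      unfolding hamiltonian_def by (auto intro!: derivative_eq_intros)
    have "L1 ?P (h, 0, 0) + w s t \<bullet> f1 ?P (h, 0, 0) = h \<bullet> Dx" for h
      using has_derivative_unique[OF 1[unfolded prod.case] Dx[unfolded gderiv_def hamiltonian_def]] by (auto dest: fun_cong)
    moreover have "L1 ?P (0, h, 0) + w s t \<bullet> f1 ?P (0, h, 0) = h \<bullet> Dv" for h
      using has_derivative_unique[OF 2[unfolded prod.case] Dv[unfolded gderiv_def hamiltonian_def]] by (auto dest: fun_cong)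
    moreover have "h \<bullet> ?f ?P = h \<bullet> Dw" for h
      using has_derivative_unique[OF 3 Dw[unfolded gderiv_def]] by (auto dest: fun_cong)
    moreover have "?z' s t = (x' s t, 0, 0) + (0, v' s t, 0)" by simp
    ultimately show ?thesis
      unfolding E_def by (simp only: blinfun.add_right inner_add_right) (simp add: algebra_simps)
  qed
  show ?thesis using that[OF 1 2] .
qed

section \<open>The fractional Noether identity\<close>

lemma has_vector_derivative_inner:
  assumes "(f has_vector_derivative f') (at t within S)" "(g has_vector_derivative g') (at t within S)"
  shows "((\<lambda>t. f t \<bullet> g t) has_vector_derivative f' \<bullet> g t + f t \<bullet> g') (at t within S)"
  using bounded_bilinear.has_vector_derivative[OF bounded_bilinear_inner assms] by (simp add: add.commute)

lemma bounded_frac_int_left: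
  fixes G :: "real \<Rightarrow> 'a::euclidean_space"
  assumes "0 \<le> \<beta>" "continuous_on {a..b} G"
  shows "bounded (frac_int_left \<beta> a G ` {a..b})"
proof -
  have "bounded (G ` {a..b})"
    using assms by (intro compact_imp_bounded compact_continuous_image) auto
  then obtain B where "\<And>y. y \<in> {a..b} \<Longrightarrow> norm (G y) \<le> B"
    by (metis bounded_iff imageI)
  then show ?thesis
    using norm_frac_int_left_le[OF assms(1) _ assms(2), of _ B] unfolding bounded_iff by blast
qed

text \<open>
  Formally: \<open>p\<close> times the Caputo derivative of \<open>g\<close> equals \<open>g\<close> times the right derivative of \<open>p\<close>.
  The assertion is about the derivative of the product \<open>J \<bullet> p\<close> because the invariance controls the
  Caputo derivatives of the transported curves only through their product with \<open>\<phi>3 s p\<close>, and it is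
  this product that survives the limit \<open>s \<rightarrow> 0\<close>.
\<close>

lemma noether_first_term:
  fixes L :: "real^'d \<Rightarrow> real^'m \<Rightarrow> real \<Rightarrow> real"
    and f :: "real^'d \<Rightarrow> real^'m \<Rightarrow> real \<Rightarrow> real^'d"
  assumes \<alpha>: "\<alpha> \<le> 1"
    and L: "lagrangian a b L" and f: "constraint_function a b f"
    and \<phi>1: "one_param_group \<phi>1" and \<phi>2: "one_param_group \<phi>2" and \<phi>3: "one_param_group \<phi>3"
    and inv: "caputo_invariant \<alpha> a b A (hamiltonian L f) \<phi>1 \<phi>2 \<phi>3"
    and sol: "pontryagin_solution \<alpha> a b A (hamiltonian L f) q u p"
    and g: "g = (\<lambda>t. vector_derivative (\<lambda>s. \<phi>1 s (q t)) (at 0))"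
    and p: "\<And>t. t \<in> {a..b} \<Longrightarrow> (p has_vector_derivative p' t) (at t within {a..b})"
    and p': "continuous_on {a..b} p'"
    and \<tau>: "\<tau> \<in> {a<..<b}"
  defines "J \<equiv> frac_int_left (1 - \<alpha>) a (\<lambda>y. g y - g a)"
  shows "((\<lambda>t. J t \<bullet> p t) has_vector_derivative J \<tau> \<bullet> p' \<tau> + g \<tau> \<bullet> RL_right \<alpha> a b p \<tau>) (at \<tau>)"
proof -
  let ?K = "{a..b}" and ?O = "{a<..<b}"
  let ?H = "hamiltonian L f"
  have \<phi>0: "\<phi>1 0 x = x" "\<phi>2 0 y = y" "\<phi>3 0 z = z" for x y z
    using \<phi>1 \<phi>2 \<phi>3 by (auto simp: one_param_group_def)
  have C2: "C2_on UNIV (\<lambda>(s, x). \<phi>1 s x)" "C2_on UNIV (\<lambda>(s, x). \<phi>2 s x)" "C2_on UNIV (\<lambda>(s, x). \<phi>3 s x)"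
    using \<phi>1 \<phi>2 \<phi>3 by (auto simp: one_param_group_def)
  have cp: "continuous_on ?K p" using p by (rule continuous_on_vector_derivative)
  have cu: "continuous_on ?K u" using sol by (simp add: pontryagin_solution_def)
  have cq: "continuous_on ?K q"
  proof (cases "nat \<lfloor>\<alpha>\<rfloor>")
    case 0
    with sol show ?thesis by (simp add: pontryagin_solution_def Ck_curve_def nth_deriv_def)
  next
    case (Suc k)
    with sol have "nth_deriv a b 0 q differentiable_on ?K"
      by (auto simp: pontryagin_solution_def Ck_curve_def)
    then show ?thesis by (intro differentiable_imp_continuous_on) (simp add: nth_deriv_def)
  qed
  obtain Q' where Q: "param_C1 ?K (\<lambda>s t. \<phi>1 s (q t)) Q'" and Q0: "Q' 0 = g"
    using param_C1_flow[OF C2(1) cq] g by metis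
  \<comment> \<open>The starting point \<open>q a\<close> is moved by the flow as well, and is handled as a constant curve.\<close>
  obtain Qa' where Qa: "param_C1 ?K (\<lambda>s t. \<phi>1 s (q a)) Qa'" and Qa0: "Qa' 0 = (\<lambda>t. g a)"
    using param_C1_flow[OF C2(1) continuous_on_const[of ?K "q a"]] g by metis
  obtain U' where U: "param_C1 ?K (\<lambda>s t. \<phi>2 s (u t)) U'"
    using param_C1_flow[OF C2(2) cu] by metis
  obtain h where P: "param_C1 ?K (\<lambda>s t. \<phi>3 s (p t)) h"
    using param_C1_flow[OF C2(3) cp] by metis
  obtain P' P'' where P': "param_C1 ?K P' P''"
    and dP: "\<And>s t. t \<in> ?K \<Longrightarrow> ((\<lambda>t. \<phi>3 s (p t)) has_vector_derivative P' s t) (at t within ?K)"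
    by (rule param_C1_flow_velocity[OF C2(3) p p']) (assumption, rule that, assumption, blast)
  define X where "X = (\<lambda>s y. \<phi>1 s (q y) - \<phi>1 s (q a))"
  define I where "I = (\<lambda>s. frac_int_left (1 - \<alpha>) a (X s))"
  define W where "W = (\<lambda>s. caputo_left \<alpha> a b (\<lambda>t. \<phi>1 s (q t)))"
  have X: "param_C1 ?K X (\<lambda>s t. Q' s t - Qa' s t)"
    unfolding X_def by (intro param_C1_diff Q Qa)
  have cX: "continuous_on ?K (X s)" for s using param_C1_slice(1)[OF X] .
  have cg: "continuous_on ?K (\<lambda>y. g y - g a)"
    using param_C1_slice(2)[OF X, of 0] by (simp add: Q0 Qa0)
  have I: "param_deriv ?K I J"
    unfolding I_def J_def
  proof (rule param_deriv_frac_int_left[OF _ cX cg])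
    show "param_deriv ?K X (\<lambda>y. g y - g a)"
      using param_C1_imp_param_deriv[OF compact_Icc X] by (simp add: Q0 Qa0)
  qed (use \<alpha> in simp)
  have dI: "(I s has_vector_derivative W s t) (at t)" if "t \<in> ?O" for s t
  proof -
    have "caputo_left_exists \<alpha> a b (\<lambda>t. \<phi>1 s (q t))"
      using inv sol unfolding caputo_invariant_def by blast
    then have "I s differentiable (at t within ?K)"
      using that by (auto simp: caputo_left_exists_def RL_left_exists_def I_def X_def)
    then have "(I s has_vector_derivative W s t) (at t within ?K)"
      unfolding vector_derivative_works W_def caputo_left_def RL_left_def I_def X_def .
    then show ?thesis using that by (simp add: at_within_Icc_at)
  qed
  have bdd: "bounded (F ` ?K)" if "continuous_on ?K F" for F :: "real \<Rightarrow> real^'d"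
    using that by (intro compact_imp_bounded compact_continuous_image) auto
  have bI: "bounded (I 0 ` ?K)" and bJ: "bounded (J ` ?K)"
    using \<alpha> cX cg unfolding I_def J_def by (intro bounded_frac_int_left; simp)+
  note K = compact_Icc[of a b]
  note bP = bdd[OF param_C1_slice(1)[OF P, of 0]] bdd[OF param_C1_slice(2)[OF P, of 0]]
    bdd[OF param_C1_slice(1)[OF P', of 0]] bdd[OF param_C1_slice(2)[OF P', of 0]]
  have PI: "param_deriv ?K (\<lambda>s t. \<phi>3 s (p t) \<bullet> I s t) (\<lambda>t. h 0 t \<bullet> I 0 t + p t \<bullet> J t)"
    using param_deriv_inner[OF param_C1_imp_param_deriv[OF K P] I bP(1) bI bP(2) bJ] by (simp add: \<phi>0)
  have P'I: "param_deriv ?K (\<lambda>s t. P' s t \<bullet> I s t) (\<lambda>t. P'' 0 t \<bullet> I 0 t + P' 0 t \<bullet> J t)"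
    using param_deriv_inner[OF param_C1_imp_param_deriv[OF K P'] I bP(3) bI bP(4) bJ] .
  obtain E where E: "param_C1 ?K (\<lambda>s t. ?H (\<phi>1 s (q t)) (\<phi>2 s (u t)) (\<phi>3 s (p t)) t) E"
    and E_grad: "\<And>s t Dx Dv Dw. t \<in> ?K \<Longrightarrow>
      GDERIV (\<lambda>\<xi>. ?H \<xi> (\<phi>2 s (u t)) (\<phi>3 s (p t)) t) (\<phi>1 s (q t)) :> Dx \<Longrightarrow>
      GDERIV (\<lambda>\<eta>. ?H (\<phi>1 s (q t)) \<eta> (\<phi>3 s (p t)) t) (\<phi>2 s (u t)) :> Dv \<Longrightarrow>
      GDERIV (\<lambda>\<omega>. ?H (\<phi>1 s (q t)) (\<phi>2 s (u t)) \<omega> t) (\<phi>3 s (p t)) :> Dw \<Longrightarrow>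
      E s t = Q' s t \<bullet> Dx + U' s t \<bullet> Dv + h s t \<bullet> Dw"
    by (rule param_C1_hamiltonian[OF L f Q U P]) (rule that, assumption, blast)
  have E0: "E 0 t = g t \<bullet> RL_right \<alpha> a b p t + h 0 t \<bullet> W 0 t" if t: "t \<in> ?O" for t
  proof -
    have W0: "W 0 t = caputo_left \<alpha> a b q t" by (simp add: W_def \<phi>0)
    have "E 0 t = Q' 0 t \<bullet> RL_right \<alpha> a b p t + U' 0 t \<bullet> 0 + h 0 t \<bullet> W 0 t"
      using sol t unfolding pontryagin_solution_def W0
      by (intro E_grad) (simp_all only: \<phi>0, auto)
    then show ?thesis by (simp add: Q0)
  qed
  \<comment> \<open>By the invariance this product differs from the transported Hamiltonian by a term independent of \<open>s\<close>.\<close>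
  have PW: "param_deriv ?O (\<lambda>s t. \<phi>3 s (p t) \<bullet> W s t) (\<lambda>t. g t \<bullet> RL_right \<alpha> a b p t + h 0 t \<bullet> W 0 t)"
  proof (rule param_deriv_cong[OF param_deriv_subset[OF param_C1_imp_param_deriv[OF K E]]])
    fix s t assume "t \<in> ?O"
    then have "?H (\<phi>1 s (q t)) (\<phi>2 s (u t)) (\<phi>3 s (p t)) t - \<phi>3 s (p t) \<bullet> W s t
        = ?H (q t) (u t) (p t) t - p t \<bullet> caputo_left \<alpha> a b q t" for s
      using inv sol unfolding caputo_invariant_def W_def by auto
    from this[of s] this[of 0]
    show "\<phi>3 s (p t) \<bullet> W s t - \<phi>3 0 (p t) \<bullet> W 0 t
      = ?H (\<phi>1 s (q t)) (\<phi>2 s (u t)) (\<phi>3 s (p t)) t - ?H (\<phi>1 0 (q t)) (\<phi>2 0 (u t)) (\<phi>3 0 (p t)) t"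
      by simp
  qed (use E0 in auto)
  have sub: "?O \<subseteq> ?K" by auto
  have \<tau>K: "\<tau> \<in> ?K" using \<tau> by auto
  have at_O: "at \<tau> within ?O = at \<tau>"
    using \<tau> by (intro at_within_open) auto
  have "((\<lambda>t. h 0 t \<bullet> I 0 t + p t \<bullet> J t) has_vector_derivative
      (P'' 0 \<tau> \<bullet> I 0 \<tau> + P' 0 \<tau> \<bullet> J \<tau>) + (g \<tau> \<bullet> RL_right \<alpha> a b p \<tau> + h 0 \<tau> \<bullet> W 0 \<tau>)) (at \<tau> within ?O)"
  proof (rule param_deriv_commute[OF _ \<tau> _ param_deriv_subset[OF PI sub]
        param_deriv_add[OF param_deriv_subset[OF P'I sub] PW]])
    fix s t assume t: "t \<in> ?O"
    show "((\<lambda>t. \<phi>3 s (p t) \<bullet> I s t) has_vector_derivative P' s t \<bullet> I s t + \<phi>3 s (p t) \<bullet> W s t) (at t within ?O)"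
      using t by (intro has_vector_derivative_inner[OF has_vector_derivative_within_subset[OF dP sub]
          has_vector_derivative_at_within[OF dI]]) auto
  qed auto
  note sum_deriv = this
  have "(h 0 has_vector_derivative P'' 0 \<tau>) (at \<tau> within ?K)"
    by (rule param_deriv_commute[OF _ \<tau>K dP param_C1_imp_param_deriv[OF K P] param_C1_imp_param_deriv[OF K P']])
      auto
  then have "((\<lambda>t. h 0 t \<bullet> I 0 t) has_vector_derivative P'' 0 \<tau> \<bullet> I 0 \<tau> + h 0 \<tau> \<bullet> W 0 \<tau>) (at \<tau> within ?O)"
    by (rule has_vector_derivative_inner[OF has_vector_derivative_within_subset[OF _ sub]
          has_vector_derivative_at_within[OF dI[OF \<tau>]]])
  \<comment> \<open>Both contributions of the flow \<open>\<phi>3\<close>, its velocity at \<open>s = 0\<close> and the derivative of that velocity, cancel.\<close>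
  from has_vector_derivative_diff[OF sum_deriv this]
  have "((\<lambda>t. p t \<bullet> J t) has_vector_derivative P' 0 \<tau> \<bullet> J \<tau> + g \<tau> \<bullet> RL_right \<alpha> a b p \<tau>) (at \<tau>)"
    unfolding at_O by simp
  moreover have "P' 0 \<tau> = p' \<tau>"
    using dP[OF \<tau>K, of 0] p[OF \<tau>K] \<tau> by (simp add: \<phi>0 at_within_Icc_at vector_derivative_unique_at)
  ultimately show ?thesis by (simp add: inner_commute)
qed

section \<open>The conserved series\<close>

text \<open>
  The derivatives of the partial sums are \<open>B n - B 0\<close> and converge uniformly. Since the terms vanish
  at \<open>t0\<close>, the series converges there, and with it everywhere on \<open>[a,b]\<close>.
\<close>

lemma telescoping_series_has_derivative:
  fixes X B :: "nat \<Rightarrow> real \<Rightarrow> real"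
  assumes t0: "t0 \<in> {a..b}" and X0: "\<And>n. X n t0 = 0"
    and X: "\<And>n t. t \<in> {a..b} \<Longrightarrow> (X n has_vector_derivative B (Suc n) t - B n t) (at t within {a..b})"
    and B: "uniform_limit {a..b} B (\<lambda>t. 0) sequentially"
  obtains S where "\<And>t. t \<in> {a..b} \<Longrightarrow> (\<lambda>n. X n t) sums S t"
    "\<And>t. t \<in> {a..b} \<Longrightarrow> (S has_vector_derivative - B 0 t) (at t within {a..b})"
proof -
  have "\<exists>S. \<forall>t\<in>{a..b}. (\<lambda>n. X n t) sums S t \<and> (S has_derivative (\<lambda>h. h *\<^sub>R (- B 0 t))) (at t within {a..b})"
  proof (rule has_derivative_series[OF _ _ _ t0])
    show "(X n has_derivative (\<lambda>h. h *\<^sub>R (B (Suc n) t - B n t))) (at t within {a..b})"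
      if "t \<in> {a..b}" for n t using X[OF that] by (simp add: has_vector_derivative_def)
    show "(\<lambda>n. X n t0) sums 0" by (simp add: X0)
    fix e :: real assume "e > 0"
    from uniform_limitD[OF B this]
    show "\<forall>\<^sub>F n in sequentially. \<forall>t\<in>{a..b}. \<forall>h.
        norm ((\<Sum>i<n. h *\<^sub>R (B (Suc i) t - B i t)) - h *\<^sub>R (- B 0 t)) \<le> e * norm h"
    proof eventually_elim
      case (elim n)
      show ?case
      proof (intro ballI allI)
        fix t h :: real assume "t \<in> {a..b}"
        with elim have "\<bar>B n t\<bar> \<le> e" by (auto simp: less_imp_le)
        moreover have "(\<Sum>i<n. h *\<^sub>R (B (Suc i) t - B i t)) = h *\<^sub>R (B n t - B 0 t)"
          unfolding scaleR_sum_right[symmetric] sum_lessThan_telescope[of "\<lambda>i. B i t" n] ..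
        ultimately have "(\<Sum>i<n. h *\<^sub>R (B (Suc i) t - B i t)) - h *\<^sub>R (- B 0 t) = h * B n t"
          by (simp add: algebra_simps)
        with mult_left_mono[OF \<open>\<bar>B n t\<bar> \<le> e\<close> abs_ge_zero[of h]] show "norm ((\<Sum>i<n. h *\<^sub>R (B (Suc i) t - B i t)) - h *\<^sub>R (- B 0 t)) \<le> e * norm h"
          by (simp only: real_norm_def abs_mult mult.commute[of e])
      qed
    qed
  qed simp
  then obtain S where S: "\<forall>t\<in>{a..b}. (\<lambda>n. X n t) sums S t \<and>
      (S has_derivative (\<lambda>h. h *\<^sub>R (- B 0 t))) (at t within {a..b})" by blast
  show ?thesis by (rule that[of S]) (use S in \<open>simp_all add: has_vector_derivative_def\<close>)
qed

lemma smooth_curve_nth_deriv: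
  assumes "smooth_curve a b g" "t \<in> {a..b}"
  shows "(nth_deriv a b r g has_vector_derivative nth_deriv a b (Suc r) g t) (at t within {a..b})"
proof -
  have "nth_deriv a b r g differentiable (at t within {a..b})"
    using assms unfolding smooth_curve_def Ck_curve_def differentiable_on_def by blast
  then show ?thesis by (simp add: vector_derivative_works nth_deriv_def)
qed

lemma frac_int_left_at_start: "\<beta> \<noteq> 0 \<Longrightarrow> frac_int_left \<beta> a G a = 0"
  by (simp add: frac_int_left_def)

lemma frac_int_right_at_end: "\<beta> \<noteq> 0 \<Longrightarrow> frac_int_right \<beta> b G b = 0"
  by (simp add: frac_int_right_def)

theorem theorem14:
  fixes a b \<alpha> :: real
    and A :: "real^'d"
    and L :: "real^'d \<Rightarrow> real^'m \<Rightarrow> real \<Rightarrow> real"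
    and f :: "real^'d \<Rightarrow> real^'m \<Rightarrow> real \<Rightarrow> real^'d"
    and \<phi>1 \<phi>3 :: "real \<Rightarrow> real^'d \<Rightarrow> real^'d"
    and \<phi>2 :: "real \<Rightarrow> real^'m \<Rightarrow> real^'m"
    and q p g :: "real \<Rightarrow> real^'d"
    and u :: "real \<Rightarrow> real^'m"
  assumes "a < b" and "0 < \<alpha>" and "\<alpha> \<le> 1"
    and "lagrangian a b L" and "constraint_function a b f"
    and "one_param_group \<phi>1" and "one_param_group \<phi>2" and "one_param_group \<phi>3"
    and "caputo_invariant \<alpha> a b A (hamiltonian L f) \<phi>1 \<phi>2 \<phi>3"
    and "pontryagin_solution \<alpha> a b A (hamiltonian L f) q u p"
    and "g = (\<lambda>t. vector_derivative (\<lambda>s. \<phi>1 s (q t)) (at 0))"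
    and "smooth_curve a b g" and "smooth_curve a b p"
    and "condition_C \<alpha> a b g p"
  defines "c \<equiv> (\<lambda>r t.
      (- 1) ^ r * (frac_int_left (real r + 1 - \<alpha>) a (\<lambda>y. g y - g a) t \<bullet> nth_deriv a b r p t)
      + nth_deriv a b r g t \<bullet> frac_int_right (real r + 1 - \<alpha>) b p t)"
  shows "(\<forall>t\<in>{a<..<b}. summable (\<lambda>r. c r t)) \<and>
    (\<forall>t\<in>{a<..<b}. ((\<lambda>\<tau>. \<Sum>r. c r \<tau>) has_real_derivative 0) (at t))"
proof -
  let ?K = "{a..b}"
  let ?G = "\<lambda>y. g y - g a"
  define l where "l = (\<lambda>n. frac_int_left (real n - \<alpha>) a ?G)"
  define r where "r = (\<lambda>n. frac_int_right (real n - \<alpha>) b p)"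
  define dg where "dg = (\<lambda>n. nth_deriv a b n g)"
  define dp where "dp = (\<lambda>n. nth_deriv a b n p)"
  have dg: "(dg n has_vector_derivative dg (Suc n) t) (at t within ?K)"
    and dp: "(dp n has_vector_derivative dp (Suc n) t) (at t within ?K)" if "t \<in> ?K" for n t
    unfolding dg_def dp_def using smooth_curve_nth_deriv that assms(12,13) by blast+
  have zero: "dg 0 = g" "dp 0 = p" by (simp_all add: dg_def dp_def nth_deriv_def)
  have cdg: "continuous_on ?K (dg n)" and cdp: "continuous_on ?K (dp n)" for n
    using dg dp by (blast intro: continuous_on_vector_derivative)+
  have cG: "continuous_on ?K ?G" using cdg[of 0] by (auto simp: zero intro!: continuous_intros)
  have cp: "continuous_on ?K p" using cdp[of 0] by (simp add: zero)
  have pb: "p b = 0" using assms(10) by (simp add: pontryagin_solution_def)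
  have l: "(l (Suc (Suc n)) has_vector_derivative l (Suc n) t) (at t within ?K)" if "t \<in> ?K" for n t
    using frac_int_left_has_vector_derivative[of "real (Suc n) - \<alpha>", OF _ that cG] \<open>\<alpha> \<le> 1\<close>
    by (simp add: l_def algebra_simps)
  have r: "(r (Suc (Suc n)) has_vector_derivative - r (Suc n) t) (at t within ?K)" if "t \<in> ?K" for n t
    using frac_int_right_has_vector_derivative[of "real (Suc n) - \<alpha>", OF _ that cp pb] \<open>\<alpha> \<le> 1\<close>
    by (simp add: r_def algebra_simps)
  have c: "c n t = (- 1) ^ n * (l (Suc n) t \<bullet> dp n t) + dg n t \<bullet> r (Suc n) t" for n t
    by (simp add: c_def l_def r_def dg_def dp_def algebra_simps)
  from \<open>condition_C \<alpha> a b g p\<close>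
  have limL: "uniform_limit ?K (\<lambda>n t. l (Suc n) t \<bullet> dp (Suc n) t) (\<lambda>t. 0) sequentially"
    and limR: "uniform_limit ?K (\<lambda>n t. dg (Suc n) t \<bullet> r (Suc n) t) (\<lambda>t. 0) sequentially"
    by (simp_all add: condition_C_def l_def r_def dg_def dp_def)
  \<comment> \<open>The sign makes the derivatives of the left halves telescope; it does not affect the convergence to \<open>0\<close>.\<close>
  have limL': "uniform_limit ?K (\<lambda>n t. (- 1) ^ n * (l (Suc n) t \<bullet> dp (Suc n) t)) (\<lambda>t. 0) sequentially"
    by (rule metric_uniform_limit_imp_uniform_limit[OF limL]) (simp add: abs_mult)
  obtain SL where SL: "\<And>t. t \<in> ?K \<Longrightarrow> (\<lambda>n. (- 1) ^ Suc n * (l (Suc (Suc n)) t \<bullet> dp (Suc n) t)) sums SL t"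
    and SL': "\<And>t. t \<in> ?K \<Longrightarrow> (SL has_vector_derivative - ((- 1) ^ 0 * (l (Suc 0) t \<bullet> dp (Suc 0) t))) (at t within ?K)"
  proof (rule telescoping_series_has_derivative[OF _ _ _ limL', of a
        "\<lambda>n t. (- 1) ^ Suc n * (l (Suc (Suc n)) t \<bullet> dp (Suc n) t)"])
    show "a \<in> ?K" using \<open>a < b\<close> by simp
    show "(- 1) ^ Suc n * (l (Suc (Suc n)) a \<bullet> dp (Suc n) a) = 0" for n
      using \<open>\<alpha> \<le> 1\<close> by (simp add: l_def frac_int_left_at_start)
    fix n t assume "t \<in> ?K"
    then have "((\<lambda>t. (- 1) ^ Suc n * (l (Suc (Suc n)) t \<bullet> dp (Suc n) t)) has_vector_derivative
        (- 1) ^ Suc n * (l (Suc n) t \<bullet> dp (Suc n) t + l (Suc (Suc n)) t \<bullet> dp (Suc (Suc n)) t)) (at t within ?K)"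
      by (intro has_vector_derivative_mult_right has_vector_derivative_inner l dp)
    moreover have "(- 1) ^ Suc n * (l (Suc n) t \<bullet> dp (Suc n) t + l (Suc (Suc n)) t \<bullet> dp (Suc (Suc n)) t)
      = (- 1) ^ Suc n * (l (Suc (Suc n)) t \<bullet> dp (Suc (Suc n)) t) - (- 1) ^ n * (l (Suc n) t \<bullet> dp (Suc n) t)"
      by (simp add: algebra_simps)
    ultimately show "((\<lambda>t. (- 1) ^ Suc n * (l (Suc (Suc n)) t \<bullet> dp (Suc n) t)) has_vector_derivative
        (- 1) ^ Suc n * (l (Suc (Suc n)) t \<bullet> dp (Suc (Suc n)) t)
        - (- 1) ^ n * (l (Suc n) t \<bullet> dp (Suc n) t)) (at t within ?K)"
      by (simp only:)
  qed (rule that, assumption, assumption)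
  obtain SR where SR: "\<And>t. t \<in> ?K \<Longrightarrow> (\<lambda>n. dg (Suc n) t \<bullet> r (Suc (Suc n)) t) sums SR t"
    and SR': "\<And>t. t \<in> ?K \<Longrightarrow> (SR has_vector_derivative - (dg (Suc 0) t \<bullet> r (Suc 0) t)) (at t within ?K)"
  proof (rule telescoping_series_has_derivative[OF _ _ _ limR, of b "\<lambda>n t. dg (Suc n) t \<bullet> r (Suc (Suc n)) t"])
    show "b \<in> ?K" using \<open>a < b\<close> by simp
    show "dg (Suc n) b \<bullet> r (Suc (Suc n)) b = 0" for n
      using \<open>\<alpha> \<le> 1\<close> by (simp add: r_def frac_int_right_at_end)
    fix n t assume t: "t \<in> ?K"
    show "((\<lambda>t. dg (Suc n) t \<bullet> r (Suc (Suc n)) t) has_vector_derivative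
        dg (Suc (Suc n)) t \<bullet> r (Suc (Suc n)) t - dg (Suc n) t \<bullet> r (Suc n) t) (at t within ?K)"
      using has_vector_derivative_inner[OF dg[OF t] r[OF t], of "Suc n" n] by simp
  qed (rule that, assumption, assumption)
  have sums: "(\<lambda>n. c n t) sums (SL t + SR t + c 0 t)" if "t \<in> ?K" for t
    using sums_Suc[of "\<lambda>n. c n t", OF sums_add[OF SL[OF that] SR[OF that], folded c]] .
  have deriv: "((\<lambda>t. SL t + SR t + c 0 t) has_vector_derivative 0) (at t)" if t: "t \<in> {a<..<b}" for t
  proof -
    have tK: "t \<in> ?K" and at: "at t within ?K = at t" using t by (auto simp: at_within_Icc_at)
    have "((\<lambda>t. l (Suc 0) t \<bullet> p t) has_vector_derivative l (Suc 0) t \<bullet> dp (Suc 0) t + g t \<bullet> RL_right \<alpha> a b p t) (at t)"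
      using noether_first_term[OF assms(3-11) dp[where n = 0, unfolded zero] cdp t] by (simp add: l_def)
    moreover have "(r (Suc 0) has_vector_derivative - RL_right \<alpha> a b p t) (at t)"
    proof -
      have "r (Suc 0) differentiable (at t within ?K)"
        using assms(10) t by (auto simp: pontryagin_solution_def RL_right_exists_def r_def)
      then show ?thesis unfolding vector_derivative_works by (simp add: RL_right_def r_def at)
    qed
    then have "((\<lambda>t. g t \<bullet> r (Suc 0) t) has_vector_derivative
        dg (Suc 0) t \<bullet> r (Suc 0) t + g t \<bullet> - RL_right \<alpha> a b p t) (at t)"
      using dg[OF tK, of 0] by (intro has_vector_derivative_inner) (simp_all add: zero at)
    ultimately have "((\<lambda>t. l (Suc 0) t \<bullet> p t + g t \<bullet> r (Suc 0) t) has_vector_derivative (l (Suc 0) t \<bullet> dp (Suc 0) t + g t \<bullet> RL_right \<alpha> a b p t)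
        + (dg (Suc 0) t \<bullet> r (Suc 0) t + g t \<bullet> - RL_right \<alpha> a b p t)) (at t)"
      by (rule has_vector_derivative_add)
    moreover have "c 0 = (\<lambda>t. l (Suc 0) t \<bullet> p t + g t \<bullet> r (Suc 0) t)" by (simp add: fun_eq_iff c zero)
    ultimately have "(c 0 has_vector_derivative (l (Suc 0) t \<bullet> dp (Suc 0) t + g t \<bullet> RL_right \<alpha> a b p t)
        + (dg (Suc 0) t \<bullet> r (Suc 0) t + g t \<bullet> - RL_right \<alpha> a b p t)) (at t)"
      by simp
    from has_vector_derivative_add[OF has_vector_derivative_add[OF SL'[OF tK] SR'[OF tK], unfolded at] this]
    show ?thesis by simp
  qed
  show ?thesis
  proof (intro conjI ballI)
    fix t assume t: "t \<in> {a<..<b}"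
    show "summable (\<lambda>n. c n t)" using sums[of t] t by (auto simp: sums_iff)
    have "((\<lambda>\<tau>. \<Sum>n. c n \<tau>) has_vector_derivative 0) (at t)"
      by (rule has_vector_derivative_transform_within_open[OF deriv[OF t] _ t])
        (use sums in \<open>auto simp: sums_iff\<close>)
    then show "((\<lambda>\<tau>. \<Sum>n. c n \<tau>) has_real_derivative 0) (at t)"
      by (simp add: has_real_derivative_iff_has_vector_derivative)
  qed
qed

end
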